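(* Suppose $n=p^k$ with $p$ prime and $k\ge1$, or $n=pq$ with $p,q$ distinct primes, or $n=12$. Then for every realizable flag type $T$ of degree $n$ there exists a prime tower type $(p_1,\dots,p_t)$ of degree $n$ with $T\ge T(p_1,\dots,p_t)$.
   Context: Let $[n]=\{0,\dots,n-1\}$. A flag type of degree $n$ is a function $T:[n]\times[n]\to[n]$ such that $T(i,j)=T(j,i)$, $T(i,0)=i$, and $T(i,j)\le T(i+1,j)$ for $i<n-1$. A flag of a finite abelian group $G$ of order $n$ (written multiplicatively) is a chain of subsets $\{1\}=F_0\subset\cdots\subset F_{n-1}=G$ with $|F_i|=i+1$; a flag of a degree $n$ field extension $L/K$ is a chain of $K$-subspaces $K=F_0\subset\cdots\subset F_{n-1}=L$ with $\dim_KF_i=i+1$. The flag type of a flag is $T_{\mathcal F}(i,j)=\min\{k: F_iF_j\subseteq F_k\}$, where $F_iF_j$ is the set of products (groups) or the $K$-span of products (fields). A flag type is realizable if it equals $T_{\mathcal F}$ for some flag of a finite abelian group or finite field extension. $T\le T'$ iff $T(i,j)\le T'(i,j)$ for all $i,j$. A prime tower type of degree $n$ is a tuple $(p_1,\dots,p_t)$ of primes with product $n$. Writing $m\in[n]$ as $m=m_1+m_2p_1+\cdots+m_tp_1\cdots p_{t-1}$ ($0\le m_s<p_s$), let $H=C_{p_1}\times\cdots\times C_{p_t}$, $e_s$ a generator of the $s$-th factor, $v_m=e_1^{m_1}\cdots e_t^{m_t}$, $F_m=\{v_0,\dots,v_m\}$; $T(p_1,\dots,p_t)$ is the flag type of this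 flag of $H$. *)

theory Defs
  imports "HOL-Algebra.Algebra" "HOL-Computational_Algebra.Primes"
begin

text \<open>
  A function on \<open>[n] \<times> [n]\<close> is represented by a function \<open>nat \<Rightarrow> nat \<Rightarrow> nat\<close>, of which only the
  values at arguments below \<open>n\<close> matter.  Likewise a flag is a sequence of sets of which only the
  members with index below \<open>n\<close> matter.
\<close>

definition flag_type :: "nat \<Rightarrow> (nat \<Rightarrow> nat \<Rightarrow> nat) \<Rightarrow> bool" where
  "flag_type n T \<longleftrightarrow>
     (\<forall>i<n. \<forall>j<n. T i j < n) \<and>
     (\<forall>i<n. \<forall>j<n. T i j = T j i) \<and>
     (\<forall>i<n. T i 0 = i) \<and>
     (\<forall>i j. i + 1 < n \<longrightarrow> j < n \<longrightarrow> T i j \<le> T (i + 1) j)"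

definition flag_type_le :: "nat \<Rightarrow> (nat \<Rightarrow> nat \<Rightarrow> nat) \<Rightarrow> (nat \<Rightarrow> nat \<Rightarrow> nat) \<Rightarrow> bool" where
  "flag_type_le n T T' \<longleftrightarrow> (\<forall>i<n. \<forall>j<n. T i j \<le> T' i j)"

definition group_flag :: "nat \<Rightarrow> ('a, 'c) monoid_scheme \<Rightarrow> (nat \<Rightarrow> 'a set) \<Rightarrow> bool" where
  "group_flag n G F \<longleftrightarrow>
     F 0 = {\<one>\<^bsub>G\<^esub>} \<and> F (n - 1) = carrier G \<and>
     (\<forall>i. i + 1 < n \<longrightarrow> F i \<subseteq> F (i + 1)) \<and>
     (\<forall>i<n. card (F i) = i + 1)"

definition group_flag_type :: "nat \<Rightarrow> ('a, 'c) monoid_scheme \<Rightarrow> (nat \<Rightarrow> 'a set) \<Rightarrow> nat \<Rightarrow> nat \<Rightarrow> nat" where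
  "group_flag_type n G F i j = (LEAST k. k < n \<and> F i <#>\<^bsub>G\<^esub> F j \<subseteq> F k)"

text \<open>
  The \<open>K\<close>-span of an arbitrary subset: HOL-Algebra's \<open>Span\<close> takes a finite list of vectors.
\<close>

definition set_span :: "('a, 'c) ring_scheme \<Rightarrow> 'a set \<Rightarrow> 'a set \<Rightarrow> 'a set" where
  "set_span L K S = (\<Union>Us \<in> lists S. ring.Span L K Us)"

text \<open>
  HOL-Algebra's \<open>subalgebra K V L\<close> says that \<open>V\<close> is a \<open>K\<close>-linear subspace of \<open>L\<close> (closure under
  multiplication by elements of \<open>V\<close> is not required).
\<close>

definition field_flag :: "nat \<Rightarrow> 'a set \<Rightarrow> ('a, 'c) ring_scheme \<Rightarrow> (nat \<Rightarrow> 'a set) \<Rightarrow> bool" where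
  "field_flag n K L F \<longleftrightarrow>
     F 0 = K \<and> F (n - 1) = carrier L \<and>
     (\<forall>i. i + 1 < n \<longrightarrow> F i \<subseteq> F (i + 1)) \<and>
     (\<forall>i<n. subalgebra K (F i) L \<and> ring.dimension L (i + 1) K (F i))"

definition field_flag_type ::
    "nat \<Rightarrow> 'a set \<Rightarrow> ('a, 'c) ring_scheme \<Rightarrow> (nat \<Rightarrow> 'a set) \<Rightarrow> nat \<Rightarrow> nat \<Rightarrow> nat" where
  "field_flag_type n K L F i j = (LEAST k. k < n \<and> set_span L K (F i <#>\<^bsub>L\<^esub> F j) \<subseteq> F k)"

text \<open>
  HOL cannot quantify over types inside a formula, so the types carrying the groups and the
  fields are parameters.  As type variables in the hypothesis of a theorem they are universally
  quantified, hence range over all groups and all fields.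
\<close>

definition group_realizable :: "'a itself \<Rightarrow> nat \<Rightarrow> (nat \<Rightarrow> nat \<Rightarrow> nat) \<Rightarrow> bool" where
  "group_realizable _ n T \<longleftrightarrow>
     (\<exists>(G :: 'a monoid) F.
        comm_group G \<and> finite (carrier G) \<and> order G = n \<and> group_flag n G F \<and>
        (\<forall>i<n. \<forall>j<n. T i j = group_flag_type n G F i j))"

definition field_realizable :: "'b itself \<Rightarrow> nat \<Rightarrow> (nat \<Rightarrow> nat \<Rightarrow> nat) \<Rightarrow> bool" where
  "field_realizable _ n T \<longleftrightarrow>
     (\<exists>(L :: 'b ring) K F.
        field L \<and> subfield K L \<and> ring.dimension L n K (carrier L) \<and> field_flag n K L F \<and>
        (\<forall>i<n. \<forall>j<n. T i j = field_flag_type n K L F i j))"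

definition realizable :: "'a itself \<Rightarrow> 'b itself \<Rightarrow> nat \<Rightarrow> (nat \<Rightarrow> nat \<Rightarrow> nat) \<Rightarrow> bool" where
  "realizable A B n T \<longleftrightarrow> flag_type n T \<and> (group_realizable A n T \<or> field_realizable B n T)"

definition prime_tower_type :: "nat \<Rightarrow> nat list \<Rightarrow> bool" where
  "prime_tower_type n ps \<longleftrightarrow> (\<forall>p \<in> set ps. Factorial_Ring.prime p) \<and> prod_list ps = n"

text \<open>Tuples are indexed from \<open>0\<close>: the \<open>s\<close>-th digit belongs to the prime \<open>ps ! s\<close>.\<close>

definition tower_digit :: "nat list \<Rightarrow> nat \<Rightarrow> nat \<Rightarrow> nat" where
  "tower_digit ps m s = (m div prod_list (take s ps)) mod (ps ! s)"

lemma tower_digit_less: "\<forall>p \<in> set ps. Factorial_Ring.prime p \<Longrightarrow> s < length ps \<Longrightarrow> tower_digit ps m s < ps ! s"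
  by (simp add: tower_digit_def prime_gt_0_nat)

lemma tower_digit_expansion:
  assumes "m < prod_list ps"
  shows "m = (\<Sum>s<length ps. tower_digit ps m s * prod_list (take s ps))"
proof -
  have "m mod prod_list (take t ps) = (\<Sum>s<t. tower_digit ps m s * prod_list (take s ps))"
    if "t \<le> length ps" for t
    using that
  proof (induction t)
    case (Suc t)
    then have *: "prod_list (take (Suc t) ps) = prod_list (take t ps) * ps ! t"
      by (simp add: take_Suc_conv_app_nth)
    show ?case
      unfolding * mod_mult2_eq using Suc by (simp add: tower_digit_def mult.commute)
  qed simp
  from this[of "length ps"] assms show ?thesis by simp
qed

definition tower_group :: "nat list \<Rightarrow> (nat \<Rightarrow> int) monoid" where
  "tower_group ps = product_group {..<length ps} (\<lambda>s. integer_mod_group (ps ! s))"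

text \<open>
  The cyclic factors are the additive groups of residues, so \<open>1\<close> is the generator and \<open>0\<close> the
  neutral element.
\<close>

definition tower_gen :: "nat list \<Rightarrow> nat \<Rightarrow> nat \<Rightarrow> int" where
  "tower_gen ps s = (\<lambda>r\<in>{..<length ps}. if r = s then 1 else 0)"

definition tower_elt :: "nat list \<Rightarrow> nat \<Rightarrow> nat \<Rightarrow> int" where
  "tower_elt ps m =
     (\<Otimes>\<^bsub>tower_group ps\<^esub>s\<in>{..<length ps}. tower_gen ps s [^]\<^bsub>tower_group ps\<^esub> tower_digit ps m s)"

lemma comm_group_tower_group: "comm_group (tower_group ps)"
proof -
  have "group (tower_group ps)"
    by (simp add: tower_group_def)
  moreover have "x \<otimes>\<^bsub>tower_group ps\<^esub> y = y \<otimes>\<^bsub>tower_group ps\<^esub> x" for x y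
    by (simp add: tower_group_def add.commute)
  ultimately show ?thesis
    by (simp add: group.group_comm_groupI)
qed

lemma tower_elt_eq:
  assumes ps: "\<forall>p \<in> set ps. Factorial_Ring.prime p"
  shows "tower_elt ps m = (\<lambda>r\<in>{..<length ps}. int (tower_digit ps m r))"
proof -
  let ?H = "tower_group ps" and ?I = "{..<length ps}"
  interpret H: comm_group ?H by (rule comm_group_tower_group)
  have gt1: "ps ! r > 1" if "r < length ps" for r
    using ps that prime_gt_1_nat nth_mem by blast
  have gen: "tower_gen ps s \<in> carrier ?H" for s
    using gt1 by (fastforce simp: tower_group_def tower_gen_def carrier_integer_mod_group)
  have pow: "tower_gen ps s [^]\<^bsub>?H\<^esub> (k::nat) = (\<lambda>r\<in>?I. if r = s then int k mod int (ps ! r) else 0)"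
    for s k
  proof (induction k)
    case 0
    show ?case by (auto simp: tower_group_def fun_eq_iff)
  next
    case (Suc k)
    then show ?case
      by (auto simp: tower_group_def tower_gen_def fun_eq_iff mod_add_left_eq mod_add_right_eq ac_simps)
  qed
  have mult: "x \<otimes>\<^bsub>?H\<^esub> y = (\<lambda>r\<in>?I. (x r + y r) mod int (ps ! r))" for x y
    by (simp add: tower_group_def)
  have "finprod ?H (\<lambda>s. tower_gen ps s [^]\<^bsub>?H\<^esub> tower_digit ps m s) {..<t}
      = (\<lambda>r\<in>?I. if r < t then int (tower_digit ps m r) else 0)" if "t \<le> length ps" for t
    using that
  proof (induction t)
    case 0
    have "\<one>\<^bsub>?H\<^esub> = (\<lambda>r\<in>?I. 0)"
      by (auto simp: tower_group_def fun_eq_iff)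
    then show ?case by (simp add: fun_eq_iff)
  next
    case (Suc t)
    have "finprod ?H (\<lambda>s. tower_gen ps s [^]\<^bsub>?H\<^esub> tower_digit ps m s) {..<Suc t}
        = (tower_gen ps t [^]\<^bsub>?H\<^esub> tower_digit ps m t) \<otimes>\<^bsub>?H\<^esub>
          finprod ?H (\<lambda>s. tower_gen ps s [^]\<^bsub>?H\<^esub> tower_digit ps m s) {..<t}"
      unfolding lessThan_Suc by (rule H.finprod_insert) (use gen in auto)
    also have "\<dots> = (\<lambda>r\<in>?I. if r < Suc t then int (tower_digit ps m r) else 0)"
      unfolding Suc.IH[OF Suc_leD[OF Suc.prems]]
      using Suc.prems tower_digit_less[OF ps]
      by (auto simp: pow mult fun_eq_iff less_Suc_eq simp flip: of_nat_mod)
    finally show ?case .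
  qed
  from this[of "length ps"] show ?thesis
    by (auto simp: tower_elt_def fun_eq_iff)
qed

definition tower_flag :: "nat list \<Rightarrow> nat \<Rightarrow> (nat \<Rightarrow> int) set" where
  "tower_flag ps m = tower_elt ps ` {..m}"

lemma group_flag_tower_flag:
  assumes "prime_tower_type n ps"
  shows "order (tower_group ps) = n" and "group_flag n (tower_group ps) (tower_flag ps)"
proof -
  let ?H = "tower_group ps"
  have ps: "\<forall>p \<in> set ps. Factorial_Ring.prime p" and n: "prod_list ps = n"
    using assms by (auto simp: prime_tower_type_def)
  have pos: "ps ! s > 0" if "s < length ps" for s
    using ps that by (simp add: prime_gt_0_nat)
  have npos: "n > 0"
    using ps n by (metis gr0I prime_gt_0_nat less_irrefl prod_list_zero_iff)
  interpret H: comm_group ?H by (rule comm_group_tower_group)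
  have carr: "carrier ?H = (\<Pi>\<^sub>E s\<in>{..<length ps}. {0..<int (ps ! s)})"
    using pos by (force simp: tower_group_def carrier_integer_mod_group intro!: PiE_cong)
  have "card (carrier ?H) = (\<Prod>s<length ps. ps ! s)"
    unfolding carr by (simp add: card_PiE)
  also have "\<dots> = n"
    using n by (simp add: prod.list_conv_set_nth lessThan_atLeast0)
  finally show ord: "order ?H = n"
    by (simp add: order_def)
  have fin: "finite (carrier ?H)"
    unfolding carr by (intro finite_PiE) auto
  have inj: "inj_on (tower_elt ps) {..<n}"
  proof (rule inj_onI)
    fix a b assume ab: "a \<in> {..<n}" "b \<in> {..<n}" "tower_elt ps a = tower_elt ps b"
    have "tower_digit ps a s = tower_digit ps b s" if "s < length ps" for s
      using fun_cong[OF ab(3), of s] that by (simp add: tower_elt_eq[OF ps])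
    then show "a = b"
      using tower_digit_expansion[of a ps] tower_digit_expansion[of b ps] ab n by simp
  qed
  have card: "card (tower_flag ps i) = i + 1" if "i < n" for i
  proof -
    have "inj_on (tower_elt ps) {..i}"
      by (rule inj_on_subset[OF inj]) (use that in auto)
    then show ?thesis
      by (simp add: tower_flag_def card_image)
  qed
  have sub: "tower_flag ps i \<subseteq> carrier ?H" for i
    using tower_digit_less[OF ps] by (auto simp: tower_flag_def tower_elt_eq[OF ps] carr)
  have "tower_flag ps (n - 1) = carrier ?H"
    using card_subset_eq[OF fin sub] card[of "n - 1"] npos ord by (simp add: order_def)
  moreover have "tower_flag ps 0 = {\<one>\<^bsub>?H\<^esub>}"
    by (auto simp: tower_flag_def tower_elt_eq[OF ps] tower_digit_def tower_group_def fun_eq_iff)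
  moreover have "tower_flag ps i \<subseteq> tower_flag ps (i + 1)" for i
    by (auto simp: tower_flag_def)
  ultimately show "group_flag n ?H (tower_flag ps)"
    using card by (auto simp: group_flag_def)
qed

definition tower_flag_type :: "nat list \<Rightarrow> nat \<Rightarrow> nat \<Rightarrow> nat" where
  "tower_flag_type ps = group_flag_type (prod_list ps) (tower_group ps) (tower_flag ps)"

end

theory Submission
  imports Defs
begin

text \<open>
  Kneser's theorem, for finite abelian groups and for arbitrary finite field extensions, gives for
  \<open>H\<close> the stabilizer of \<open>F_i F_j\<close> the bound \<open>T(i,j) + 1 \<ge> |F_i H| + |F_j H| - |H|\<close>, hence with \<open>h = |H|\<close>
  the bound \<open>T(i,j) + 1 \<ge> h (i div h + j div h + 1)\<close>. Addition without carry shows that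
  \<open>T(p_1,...,p_t)(i,j) + 1\<close> is at most the same expression for every \<open>h = p_1 ... p_s\<close>. So a tower fails
  at \<open>(i,j)\<close> only if \<open>h\<close> is not one of its partial products. For prime powers every divisor is a partial
  product. In the other cases one has to see that failures of different towers exclude each other:
  stabilizers of coprime orders with product \<open>n\<close> cannot both occur below the bound \<open>i + j\<close>, and for
  \<open>n = 12\<close> the orders \<open>(4,6)\<close> and \<open>(2,3)\<close> are excluded by looking at the first few members of the flag.

  Kneser's theorem is proved by the isoperimetric method of Bachoc, Serra and Zemor. For a fixed \<open>S\<close>
  the function \<open>X \<mapsto> |X S| - |X|\<close> is submodular and invariant under a duality; by induction on its value
  \<open>l \<le> |S| - 2\<close>, a smallest saturated set of boundary \<open>l\<close> containing \<open>1\<close> is a subgroup that stabilizes all saturated sets of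
  boundary at most \<open>l\<close>. Only modular dimensions and translations enter, so groups and fields are treated at once.
\<close>

section \<open>Abelian groups with a modular system of flats\<close>

text \<open>For two cells of boundary \<open>l\<close> that meet, submodularity bounds the boundary
  of the intersection by \<open>l\<close> only if their join has boundary at least \<open>l\<close>.
  The join may well have less, and this obstacle shapes the proof: a saturated join of smaller
  boundary is stable under the subgroup \<open>M\<close> already found for the largest smaller
  boundary \<open>k\<close>, and because \<open>l\<close> lies strictly between \<open>k\<close> and
  \<open>k + d M\<close>, such stability clashes with the dimensions at hand. Most contradictions
  need both a cell and its dual. The margin 2 in the bound on \<open>l\<close> comes from Kneser's
  theorem: once A and B are replaced by AH and BH, all dimensions are multiples of
  \<open>d H\<close>, so a failure is a failure by \<open>d H\<close> and leaves a boundary of at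
  most \<open>d S - 2 * d H\<close>. In the linear model a \<open>flat_subgroup\<close> is an
  intermediate field without 0, and a union of its cosets is in general not a flat. Therefore cosets
  are never counted as a partition; they are adjoined one at a time by joins with disjoint
  flats.\<close>

definition flat_hull :: "'a set set \<Rightarrow> 'a set \<Rightarrow> 'a set" where
  "flat_hull F A = \<Inter>{V \<in> F. A \<subseteq> V}"

text \<open>
  Two models: all subsets of a finite group with their cardinality, and the sets \<open>V - {0}\<close> for the
  \<open>K\<close>-subspaces \<open>V\<close> of \<open>L\<close>, inside the multiplicative group of \<open>L\<close>, with the dimension of \<open>V\<close>. Dropping \<open>0\<close>
  makes every element invertible, and flats in general position disjoint.
\<close>

locale flat_group = comm_group G for G (structure) +
  fixes flats :: "'a set set" and d :: "'a set \<Rightarrow> nat"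
  assumes flat_subset: "V \<in> flats \<Longrightarrow> V \<subseteq> carrier G"
    and flat_carrier [simp]: "carrier G \<in> flats"
    and flat_empty [simp]: "{} \<in> flats"
    and flat_Inter: "C \<subseteq> flats \<Longrightarrow> C \<noteq> {} \<Longrightarrow> \<Inter>C \<in> flats"
    and flat_translate: "u \<in> carrier G \<Longrightarrow> V \<in> flats \<Longrightarrow> u <# V \<in> flats"
    and d_translate: "u \<in> carrier G \<Longrightarrow> V \<in> flats \<Longrightarrow> d (u <# V) = d V"
    and d_empty [simp]: "d {} = 0"
    and d_psubset: "V \<in> flats \<Longrightarrow> Y \<in> flats \<Longrightarrow> V \<subset> Y \<Longrightarrow> d V < d Y"
    and d_point: "u \<in> carrier G \<Longrightarrow> d (flat_hull flats {u}) = 1"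
    and d_modular: "V \<in> flats \<Longrightarrow> Y \<in> flats \<Longrightarrow>
      d (flat_hull flats (V \<union> Y)) + d (V \<inter> Y) = d V + d Y"
begin

abbreviation clo :: "'a set \<Rightarrow> 'a set" where "clo \<equiv> flat_hull flats"

definition join :: "'a set \<Rightarrow> 'a set \<Rightarrow> 'a set" where "join V Y = clo (V \<union> Y)"

definition mul :: "'a set \<Rightarrow> 'a set \<Rightarrow> 'a set" where "mul V Y = clo (V <#> Y)"

definition stable :: "'a set \<Rightarrow> 'a set \<Rightarrow> bool" where
  "stable H V \<longleftrightarrow> (\<forall>h\<in>H. \<forall>x\<in>V. h \<otimes> x \<in> V)"

definition flat_subgroup :: "'a set \<Rightarrow> bool" where
  "flat_subgroup H \<longleftrightarrow> subgroup H G \<and> H \<in> flats"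

abbreviation n :: nat where "n \<equiv> d (carrier G)"

lemma in_carrier: "V \<in> flats \<Longrightarrow> x \<in> V \<Longrightarrow> x \<in> carrier G"
  using flat_subset by blast

lemma flat_Int [simp]: "V \<in> flats \<Longrightarrow> Y \<in> flats \<Longrightarrow> V \<inter> Y \<in> flats"
  using flat_Inter[of "{V, Y}"] by simp

lemma hull_flat [simp]: "A \<subseteq> carrier G \<Longrightarrow> clo A \<in> flats"
  unfolding flat_hull_def by (rule flat_Inter) (use flat_carrier in blast)+

lemma subset_hull: "A \<subseteq> clo A"
  unfolding flat_hull_def by auto

lemma hull_least: "V \<in> flats \<Longrightarrow> clo A \<subseteq> V \<longleftrightarrow> A \<subseteq> V"
  unfolding flat_hull_def by blast

lemma join_flat [simp]: "V \<in> flats \<Longrightarrow> Y \<in> flats \<Longrightarrow> join V Y \<in> flats"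
  unfolding join_def by (simp add: flat_subset)

lemma join_least: "Z \<in> flats \<Longrightarrow> join V Y \<subseteq> Z \<longleftrightarrow> V \<subseteq> Z \<and> Y \<subseteq> Z"
  unfolding join_def by (simp add: hull_least)

lemma join_upper1: "V \<subseteq> join V Y" and join_upper2: "Y \<subseteq> join V Y"
  unfolding join_def using subset_hull by blast+

lemma d_join: "V \<in> flats \<Longrightarrow> Y \<in> flats \<Longrightarrow> d (join V Y) + d (V \<inter> Y) = d V + d Y"
  unfolding join_def by (rule d_modular)

lemma d_mono: "V \<in> flats \<Longrightarrow> Y \<in> flats \<Longrightarrow> V \<subseteq> Y \<Longrightarrow> d V \<le> d Y"
  by (metis d_psubset less_imp_le order_refl psubsetI)

lemma d_le_n: "V \<in> flats \<Longrightarrow> d V \<le> n"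
  by (simp add: d_mono flat_subset)

lemma flat_eqI: "V \<in> flats \<Longrightarrow> Y \<in> flats \<Longrightarrow> V \<subseteq> Y \<Longrightarrow> d Y \<le> d V \<Longrightarrow> V = Y"
  by (metis d_psubset leD psubsetI)

lemma d_pos: "V \<in> flats \<Longrightarrow> V \<noteq> {} \<Longrightarrow> 0 < d V"
  by (metis d_empty d_psubset empty_subsetI flat_empty psubsetI)

lemma d_join_point:
  assumes "V \<in> flats" "u \<in> carrier G" "u \<notin> V"
  shows "d (join V (clo {u})) = d V + 1"
proof -
  have u: "clo {u} \<in> flats" using assms by simp
  have "V \<inter> clo {u} \<subset> clo {u}" using assms(3) subset_hull[of "{u}"] by auto
  then have "d (V \<inter> clo {u}) < 1"
    using d_psubset[of "V \<inter> clo {u}" "clo {u}"] assms u d_point by auto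
  then show ?thesis using d_join[OF assms(1) u] d_point[OF assms(2)] by simp
qed

lemma exists_hyperplane:
  assumes "V \<in> flats" "V \<noteq> {}"
  obtains Z where "Z \<in> flats" "Z \<subset> V" "d Z + 1 = d V"
proof -
  let ?P = "\<lambda>Z. Z \<in> flats \<and> Z \<subset> V"
  have "?P {}" using assms by auto
  moreover have "\<forall>Y. ?P Y \<longrightarrow> d Y < d V" using assms d_psubset by blast
  ultimately have "\<exists>Z. ?P Z \<and> (\<forall>Y. ?P Y \<longrightarrow> d Y \<le> d Z)" by (rule ex_has_greatest_nat)
  then obtain Z where Z: "?P Z" and max: "\<And>Y. ?P Y \<Longrightarrow> d Y \<le> d Z" by blast
  obtain u where u: "u \<in> V" "u \<notin> Z" using Z by blast
  let ?J = "join Z (clo {u})"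
  have uc: "u \<in> carrier G" using u assms in_carrier by blast
  have J: "?J \<in> flats" "?J \<subseteq> V" "d ?J = d Z + 1"
    using Z assms u uc d_join_point[of Z u] by (auto simp: join_least hull_least)
  then have "?J = V" using max[of ?J] by auto
  then show ?thesis using that Z J by auto
qed

section \<open>Translates, products and stable flats\<close>

lemma mem_l_coset:
  assumes "u \<in> carrier G" "V \<subseteq> carrier G"
  shows "y \<in> u <# V \<longleftrightarrow> y \<in> carrier G \<and> inv u \<otimes> y \<in> V"
proof
  assume "y \<in> u <# V"
  then obtain x where "x \<in> V" "y = u \<otimes> x" by (auto simp: l_coset_def)
  then show "y \<in> carrier G \<and> inv u \<otimes> y \<in> V"
    using assms by (auto simp: subsetD m_assoc[symmetric])
next
  assume y: "y \<in> carrier G \<and> inv u \<otimes> y \<in> V"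
  then have "y = u \<otimes> (inv u \<otimes> y)" using assms by (simp add: m_assoc[symmetric])
  then show "y \<in> u <# V" using y by (auto simp: l_coset_def)
qed

text \<open>An intersection of translates of \<open>V\<close>. The sets \<open>perp\<close>,
  \<open>sat\<close>, \<open>stabilizer\<close> and, up to intersecting with \<open>V\<close>,
  \<open>core\<close> have this form, hence are flats.\<close>

lemma flat_quotient:
  assumes "A \<subseteq> carrier G" "V \<in> flats"
  shows "{y \<in> carrier G. \<forall>a\<in>A. a \<otimes> y \<in> V} \<in> flats"
proof -
  \<comment> \<open>The carrier is inserted to keep the family nonempty when \<open>A\<close> is
    empty.\<close>
  have "{y \<in> carrier G. \<forall>a\<in>A. a \<otimes> y \<in> V} = \<Inter>(insert (carrier G) ((\<lambda>a. inv a <# V) ` A))"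
    using assms flat_subset[OF assms(2)] by (auto simp: mem_l_coset subsetD)
  also have "\<dots> \<in> flats"
    by (rule flat_Inter) (use assms flat_translate in auto)
  finally show ?thesis .
qed

lemma flat_quotient1:
  assumes "a \<in> carrier G" "V \<in> flats"
  shows "{y \<in> carrier G. a \<otimes> y \<in> V} \<in> flats"
  using flat_quotient[of "{a}" V] assms by simp

lemma mul_flat [simp]: "V \<subseteq> carrier G \<Longrightarrow> Y \<subseteq> carrier G \<Longrightarrow> mul V Y \<in> flats"
  unfolding mul_def by (simp add: set_mult_closed)

lemma mul_least: "Z \<in> flats \<Longrightarrow> mul V Y \<subseteq> Z \<longleftrightarrow> (\<forall>x\<in>V. \<forall>y\<in>Y. x \<otimes> y \<in> Z)"
  unfolding mul_def by (auto simp: hull_least set_mult_def)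

lemma mulI: "x \<in> V \<Longrightarrow> y \<in> Y \<Longrightarrow> x \<otimes> y \<in> mul V Y"
  unfolding mul_def using subset_hull[of "V <#> Y"] by (auto simp: set_mult_def)

lemma mul_mono: "V' \<subseteq> carrier G \<Longrightarrow> Y' \<subseteq> carrier G \<Longrightarrow> V \<subseteq> V' \<Longrightarrow> Y \<subseteq> Y' \<Longrightarrow> mul V Y \<subseteq> mul V' Y'"
  by (auto simp: mul_least intro!: mulI)

lemma mul_commute: "V \<subseteq> carrier G \<Longrightarrow> Y \<subseteq> carrier G \<Longrightarrow> mul V Y = mul Y V"
proof -
  have "A <#> B \<subseteq> B <#> A" if "A \<subseteq> carrier G" "B \<subseteq> carrier G" for A B
  proof
    fix z assume "z \<in> A <#> B"
    then obtain a b where "a \<in> A" "b \<in> B" "z = a \<otimes> b"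
      by (auto simp: set_mult_def)
    then have "a \<in> A" "b \<in> B" "z = b \<otimes> a" using that m_comm by auto
    then show "z \<in> B <#> A" by (auto simp: set_mult_def)
  qed
  then show "mul V Y = mul Y V" if "V \<subseteq> carrier G" "Y \<subseteq> carrier G"
    using that by (metis mul_def subset_antisym)
qed

lemma hull_ind:
  assumes "x \<in> clo A" "A \<subseteq> carrier G" "\<And>a. a \<in> A \<Longrightarrow> a \<in> V" "V \<in> flats"
  shows "x \<in> V"
  using assms hull_least by blast

text \<open>Stands in for distributivity: the \<open>x\<close> with
  \<open>y \<otimes> x \<in> Z\<close> form a flat, so testing generators is enough.\<close>

lemma hull_mult_least:
  assumes "A \<subseteq> carrier G" "y \<in> carrier G" "Z \<in> flats" "x \<in> clo A"
    and "\<And>a. a \<in> A \<Longrightarrow> y \<otimes> a \<in> Z"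
  shows "y \<otimes> x \<in> Z"
  using hull_ind[OF assms(4,1), of "{x \<in> carrier G. y \<otimes> x \<in> Z}"] assms flat_quotient1[OF assms(2,3)]
  by auto

lemma stable_hull:
  assumes "A \<subseteq> carrier G" "H \<subseteq> carrier G" "stable H A"
  shows "stable H (clo A)"
  unfolding stable_def
proof (intro ballI)
  fix h x assume "h \<in> H" "x \<in> clo A"
  then show "h \<otimes> x \<in> clo A"
    using hull_mult_least[of A h "clo A" x] assms subset_hull[of A]
    by (simp add: stable_def subset_iff)
qed

lemma stable_join:
  assumes "V \<in> flats" "Y \<in> flats" "H \<subseteq> carrier G" "stable H V" "stable H Y"
  shows "stable H (join V Y)"
  unfolding join_def by (rule stable_hull) (use assms flat_subset in \<open>auto simp: stable_def\<close>)

lemma stable_mul: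
  assumes "V \<subseteq> carrier G" "Y \<subseteq> carrier G" "H \<subseteq> carrier G" "stable H V"
  shows "stable H (mul V Y)"
  unfolding mul_def
proof (rule stable_hull)
  show "stable H (V <#> Y)"
    using assms by (auto simp: stable_def set_mult_def subsetD m_assoc[symmetric])
qed (use assms set_mult_closed in auto)

lemma stable_translate:
  assumes "V \<in> flats" "H \<subseteq> carrier G" "stable H V" "u \<in> carrier G"
  shows "stable H (u <# V)"
proof -
  have "h \<otimes> (u \<otimes> x) = u \<otimes> (h \<otimes> x)" if "h \<in> H" "x \<in> V" for h x
    using assms that in_carrier by (meson m_lcomm subsetD)
  then show ?thesis using assms by (fastforce simp: stable_def l_coset_def)
qed

lemma flat_subgroupD:
  assumes "flat_subgroup H"
  shows "H \<in> flats" "H \<subseteq> carrier G" "\<one> \<in> H" "stable H H" "subgroup H G" "0 < d H"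
proof -
  show "H \<in> flats" "subgroup H G" using assms by (auto simp: flat_subgroup_def)
  then show "H \<subseteq> carrier G" "\<one> \<in> H" "stable H H" "0 < d H"
    using d_pos[of H] by (auto simp: subgroup.subset subgroup.one_closed stable_def subgroup.m_closed
        dest: subgroup.one_closed)
qed

lemma stable_inv:
  assumes "subgroup H G" "stable H V" "V \<subseteq> carrier G" "h \<in> H" "x \<in> carrier G" "h \<otimes> x \<in> V"
  shows "x \<in> V"
proof -
  have h: "h \<in> carrier G" "inv h \<in> H" 
    using subgroup.mem_carrier[OF assms(1,4)] subgroup.m_inv_closed[OF assms(1,4)] by simp_all
  then have "inv h \<otimes> (h \<otimes> x) \<in> V" using assms(2,6) by (simp add: stable_def)
  moreover have "inv h \<otimes> (h \<otimes> x) = x" using h assms(5) by (simp add: m_assoc[symmetric])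
  ultimately show ?thesis by simp
qed

lemma coset_subset_stable:
  assumes "subgroup H G" "stable H V" "V \<subseteq> carrier G" "x \<in> V"
  shows "x <# H \<subseteq> V"
proof -
  have "x \<otimes> h \<in> V" if "h \<in> H" for h
    using assms(2-4) that subgroup.mem_carrier[OF assms(1) that] m_comm[of x h] by (auto simp: stable_def)
  then show ?thesis by (auto simp: l_coset_def)
qed

lemma coset_Int_stable:
  assumes "subgroup H G" "stable H V" "V \<subseteq> carrier G" "x \<in> carrier G" "x \<notin> V"
  shows "(x <# H) \<inter> V = {}"
proof -
  have "x \<in> V" if "h \<in> H" "x \<otimes> h \<in> V" for h
    using stable_inv[OF assms(1-3) that(1) assms(4)] that(2) assms(4)
      subgroup.mem_carrier[OF assms(1) that(1)] m_comm[of x h] by simp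
  then show ?thesis using assms(5) by (auto simp: l_coset_def)
qed

lemma coset_stable:
  assumes "flat_subgroup H" "x \<in> carrier G"
  shows "stable H (x <# H)" "x <# H \<in> flats" "x \<in> x <# H" "d (x <# H) = d H"
  using flat_subgroupD[OF assms(1)] assms flat_translate d_translate stable_translate
  by (auto simp: l_coset_def) (metis r_one)

text \<open>Lagrange's theorem for groups, the tower law for fields. A largest stable
  \<open>Y \<subseteq> V\<close> of dimension divisible by \<open>d H\<close> is all of
  \<open>V\<close>: a coset of \<open>H\<close> through a missing point is disjoint from
  \<open>Y\<close>, so the join gains exactly \<open>d H\<close>.\<close>

lemma d_dvd:
  assumes H: "flat_subgroup H" and V: "V \<in> flats" "stable H V"
  shows "d H dvd d V"
proof -
  note H' = flat_subgroupD[OF H]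
  let ?P = "\<lambda>Y. Y \<in> flats \<and> stable H Y \<and> d H dvd d Y \<and> Y \<subseteq> V"
  have "?P {}" by (simp add: stable_def)
  moreover have "\<forall>Y. ?P Y \<longrightarrow> d Y < Suc (d V)" using V d_mono by (simp add: less_Suc_eq_le)
  ultimately have "\<exists>Y. ?P Y \<and> (\<forall>Z. ?P Z \<longrightarrow> d Z \<le> d Y)" by (rule ex_has_greatest_nat)
  then obtain Y where Y: "?P Y" and max: "\<And>Z. ?P Z \<Longrightarrow> d Z \<le> d Y" by blast
  have "Y = V"
  proof (rule ccontr)
    assume "Y \<noteq> V"
    then obtain x where x: "x \<in> V" "x \<notin> Y" using Y by blast
    have xc: "x \<in> carrier G" using x V in_carrier by blast
    note cs = coset_stable[OF H xc]
    let ?J = "join Y (x <# H)"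
    have "Y \<inter> (x <# H) = {}"
      using coset_Int_stable[OF H'(5) _ _ xc x(2)] Y flat_subset by blast
    then have dJ: "d ?J = d Y + d H" using d_join[of Y "x <# H"] Y cs by simp
    have "?P ?J" using Y cs H' V x dJ stable_join[of Y "x <# H" H] coset_subset_stable[OF H'(5) V(2) _ x(1)] flat_subset[OF V(1)]
      by (simp add: join_least)
    then show False using max[of ?J] dJ H'(6) by simp
  qed
  then show ?thesis using Y by simp
qed

lemma l_coset_cancel:
  assumes "u \<in> carrier G" "V \<subseteq> carrier G"
  shows "inv u <# (u <# V) = V" "u <# (inv u <# V) = V"
  using assms by (auto simp: mem_l_coset l_coset_subset_G m_assoc[symmetric] subsetD)

lemma l_coset_mono: "V \<subseteq> Y \<Longrightarrow> u <# V \<subseteq> u <# Y"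
  by (auto simp: l_coset_def)

lemma hull_translate:
  assumes "u \<in> carrier G" "A \<subseteq> carrier G"
  shows "clo (u <# A) = u <# clo A"
proof
  show "clo (u <# A) \<subseteq> u <# clo A"
    using assms subset_hull[of A] by (simp add: hull_least flat_translate l_coset_mono)
  have "A \<subseteq> inv u <# clo (u <# A)"
    using l_coset_mono[OF subset_hull[of "u <# A"], of "inv u"] l_coset_cancel assms by auto
  then have "clo A \<subseteq> inv u <# clo (u <# A)"
    using assms by (simp add: hull_least flat_translate l_coset_subset_G)
  then have "u <# clo A \<subseteq> u <# (inv u <# clo (u <# A))" by (rule l_coset_mono)
  then show "u <# clo A \<subseteq> clo (u <# A)"
    using l_coset_cancel(2)[of u "clo (u <# A)"] assms flat_subset[OF hull_flat, of "u <# A"] l_coset_subset_G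
    by auto
qed

lemma mul_translate:
  assumes "u \<in> carrier G" "V \<subseteq> carrier G" "Y \<subseteq> carrier G"
  shows "mul (u <# V) Y = u <# mul V Y"
proof -
  have "(u <# V) <#> Y = u <# (V <#> Y)"
    using assms unfolding l_coset_eq_set_mult by (simp add: set_mult_assoc)
  then show ?thesis unfolding mul_def using assms by (simp add: hull_translate set_mult_closed)
qed

lemma d_le_mul:
  assumes "V \<in> flats" "Y \<in> flats" "Y \<noteq> {}"
  shows "d V \<le> d (mul V Y)"
proof -
  obtain y where y: "y \<in> Y" "y \<in> carrier G" using assms in_carrier by blast
  have "y <# V \<subseteq> mul V Y"
    using y assms mulI[of _ V y Y] in_carrier m_comm by (fastforce simp: l_coset_def)
  then have "d (y <# V) \<le> d (mul V Y)"
    using assms y by (intro d_mono) (auto simp: flat_translate flat_subset)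
  then show ?thesis using d_translate y assms by simp
qed

section \<open>Duality with respect to a hyperplane\<close>

definition hyper :: "'a set" where
  "hyper = (SOME Z. Z \<in> flats \<and> Z \<subset> carrier G \<and> d Z + 1 = n)"

lemma hyper: "hyper \<in> flats" "hyper \<subset> carrier G" "d hyper + 1 = n"
proof -
  have "\<exists>Z. Z \<in> flats \<and> Z \<subset> carrier G \<and> d Z + 1 = n"
    by (rule exists_hyperplane[OF flat_carrier]) auto
  from someI_ex[OF this] show "hyper \<in> flats" "hyper \<subset> carrier G" "d hyper + 1 = n"
    unfolding hyper_def by simp_all
qed

text \<open>For fields this is the orthogonal space of the form \<open>(x, y) \<mapsto> \<sigma> (x y)\<close>, \<open>\<sigma>\<close> a nonzero functional with kernel \<open>hyper\<close>.\<close>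

definition perp :: "'a set \<Rightarrow> 'a set" where
  "perp V = {y \<in> carrier G. \<forall>x\<in>V. x \<otimes> y \<in> hyper}"

lemma perp_flat [simp]: "V \<subseteq> carrier G \<Longrightarrow> perp V \<in> flats"
  unfolding perp_def using flat_quotient hyper by blast

lemma perp_antimono: "V \<subseteq> Y \<Longrightarrow> perp Y \<subseteq> perp V"
  by (auto simp: perp_def)

lemma perp_hull:
  assumes "A \<subseteq> carrier G"
  shows "perp (clo A) = perp A"
proof
  show "perp A \<subseteq> perp (clo A)"
  proof
    fix y assume y: "y \<in> perp A"
    then have yc: "y \<in> carrier G" by (simp add: perp_def)
    have ya: "y \<otimes> a \<in> hyper" if "a \<in> A" for a
      using y that assms m_comm[OF yc, of a] by (auto simp: perp_def)
    have "x \<otimes> y \<in> hyper" if "x \<in> clo A" for x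
      using hull_mult_least[OF assms yc hyper(1) that ya]
        in_carrier[OF hull_flat[OF assms] that] m_comm[OF yc, of x] by simp
    then show "y \<in> perp (clo A)" using yc by (simp add: perp_def)
  qed
qed (rule perp_antimono[OF subset_hull])

text \<open>Adjoining \<open>u\<close> intersects \<open>perp V\<close> with a translate of
  \<open>hyper\<close>, and by modularity such a cut costs at most one dimension.\<close>

lemma d_perp_step:
  assumes "V \<in> flats" "u \<in> carrier G"
  shows "d (perp V) \<le> d (perp (join V (clo {u}))) + 1"
proof -
  let ?U = "{y \<in> carrier G. u \<otimes> y \<in> hyper}"
  have U: "?U = inv u <# hyper"
    using assms hyper(2) by (auto simp: mem_l_coset)
  then have dU: "d ?U + 1 = n" "?U \<in> flats" using hyper assms d_translate flat_translate by auto
  have "perp (join V (clo {u})) = perp (V \<union> {u})"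
  proof -
    have "join V (clo {u}) = clo (V \<union> {u})"
    proof
      show "join V (clo {u}) \<subseteq> clo (V \<union> {u})"
        using assms subset_hull[of "V \<union> {u}"] flat_subset by (auto simp: join_least hull_least)
      show "clo (V \<union> {u}) \<subseteq> join V (clo {u})"
        using assms join_upper1[of V "clo {u}"] join_upper2[of "clo {u}" V] subset_hull[of "{u}"]
        by (auto simp: hull_least)
    qed
    then show ?thesis using perp_hull[of "V \<union> {u}"] assms flat_subset by auto
  qed
  also have "\<dots> = perp V \<inter> ?U" by (auto simp: perp_def)
  finally have "d (perp (join V (clo {u}))) + d (join (perp V) ?U) = d (perp V) + d ?U"
    using d_join[of "perp V" ?U] dU assms flat_subset by simp
  moreover have "d (join (perp V) ?U) \<le> n" using dU assms flat_subset by (simp add: d_le_n)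
  ultimately show ?thesis using dU(1) by simp
qed

lemma perp_carrier: "perp (carrier G) = {}"
proof -
  have False if y: "y \<in> perp (carrier G)" for y
  proof -
    have "y \<in> carrier G" using y by (auto simp: perp_def)
    then have "x \<in> hyper" if "x \<in> carrier G" for x
      using y that by (auto simp: perp_def dest!: bspec[of _ _ "x \<otimes> inv y"] simp: m_assoc)
    then show False using hyper(2) by blast
  qed
  then show ?thesis by blast
qed

text \<open>\<open>d_perp_step\<close> along a chain from the empty flat up to \<open>V\<close>
  gives one inequality, along a chain from \<open>V\<close> up to the carrier the other. For groups,
  \<open>hyper\<close> omits a single element g, and \<open>perp V\<close> is the complement of g
  times the inverses of \<open>V\<close>.\<close>

lemma d_perp:
  assumes "V \<in> flats"
  shows "d (perp V) + d V = n"
proof (rule antisym)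
  show "n \<le> d (perp V) + d V"
    using assms
  proof (induction "d V" arbitrary: V rule: less_induct)
    case less
    show ?case
    proof (cases "V = {}")
      case True then show ?thesis by (simp add: perp_def)
    next
      case False
      then obtain Z where Z: "Z \<in> flats" "Z \<subset> V" "d Z + 1 = d V"
        using exists_hyperplane less.prems by blast
      then obtain u where u: "u \<in> V" "u \<notin> Z" by blast
      have uc: "u \<in> carrier G" using u less.prems in_carrier by blast
      have "join Z (clo {u}) = V"
        using Z u uc less.prems d_join_point[OF Z(1) uc u(2)]
        by (intro flat_eqI) (auto simp: join_least hull_least)
      then show ?thesis using d_perp_step[OF Z(1) uc] less.hyps[of Z] Z by simp
    qed
  qed
  show "d (perp V) + d V \<le> n"
    using assms
  proof (induction "n - d V" arbitrary: V rule: less_induct)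
    case less
    show ?case
    proof (cases "V = carrier G")
      case True then show ?thesis by (simp add: perp_carrier)
    next
      case False
      then obtain u where u: "u \<in> carrier G" "u \<notin> V" using less.prems flat_subset by blast
      have J: "join V (clo {u}) \<in> flats" "d (join V (clo {u})) = d V + 1"
        using less.prems u d_join_point by auto
      then have "d V + 1 \<le> n" using d_le_n by metis
      then have "n - d (join V (clo {u})) < n - d V" using J(2) by linarith
      from less.hyps[OF this J(1)] show ?thesis
        using d_perp_step[OF less.prems u(1)] J(2) by linarith
    qed
  qed
qed

lemma perp_perp:
  assumes "V \<in> flats"
  shows "perp (perp V) = V"
proof (rule flat_eqI[symmetric])
  have sub: "perp V \<subseteq> carrier G" by (auto simp: perp_def)
  then show "perp (perp V) \<in> flats" by simp
  show "V \<subseteq> perp (perp V)" using assms in_carrier m_comm by (fastforce simp: perp_def)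
  show "d (perp (perp V)) \<le> d V"
    using d_perp[OF assms] d_perp[of "perp V"] assms flat_subset by simp
qed fact

end

section \<open>Cells of a fixed flat\<close>

locale flat_group_base = flat_group +
  fixes S :: "'a set"
  assumes S_flat [simp]: "S \<in> flats" and S_nonempty: "S \<noteq> {}"
begin

definition im :: "'a set \<Rightarrow> 'a set" where "im V = mul V S"

text \<open>For flats the subtraction is never truncated: \<open>im V\<close> contains a translate
  of \<open>V\<close>, as \<open>S\<close> is nonempty.\<close>

definition bd :: "'a set \<Rightarrow> nat" where "bd V = d (im V) - d V"

text \<open>Passing to \<open>sat V\<close> keeps the image and can only lower the boundary.
  Saturated flats are determined by their image.\<close>

definition sat :: "'a set \<Rightarrow> 'a set" where "sat V = {y \<in> carrier G. \<forall>s\<in>S. s \<otimes> y \<in> im V}"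

text \<open>\<open>dual\<close> is a Galois connection whose closure is \<open>sat\<close>, and it preserves \<open>bd\<close> on saturated flats.\<close>

definition dual :: "'a set \<Rightarrow> 'a set" where "dual V = perp (im V)"

definition cell :: "'a set \<Rightarrow> bool" where "cell V \<longleftrightarrow> V \<in> flats \<and> V \<noteq> {} \<and> sat V = V"

lemma S_carrier: "S \<subseteq> carrier G"
  by (simp add: flat_subset)

lemma im_flat [simp]: "V \<in> flats \<Longrightarrow> im V \<in> flats"
  unfolding im_def by (simp add: flat_subset)

lemma im_least: "V \<in> flats \<Longrightarrow> Z \<in> flats \<Longrightarrow> im V \<subseteq> Z \<longleftrightarrow> (\<forall>x\<in>V. \<forall>s\<in>S. s \<otimes> x \<in> Z)"
  unfolding im_def using mul_least[of Z V S] m_comm in_carrier S_flat by (metis (no_types))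

lemma imI: "V \<in> flats \<Longrightarrow> x \<in> V \<Longrightarrow> s \<in> S \<Longrightarrow> s \<otimes> x \<in> im V"
  using im_least[of V "im V"] by simp

lemma im_mono: "V \<in> flats \<Longrightarrow> W \<in> flats \<Longrightarrow> V \<subseteq> W \<Longrightarrow> im V \<subseteq> im W"
  by (subst im_least) (auto intro: imI)

lemma d_im: "V \<in> flats \<Longrightarrow> d (im V) = d V + bd V"
  using d_le_mul[of V S] S_nonempty by (simp add: bd_def im_def)

lemma im_join:
  assumes "V \<in> flats" "W \<in> flats"
  shows "im (join V W) = join (im V) (im W)"
proof
  show "join (im V) (im W) \<subseteq> im (join V W)"
    using assms im_mono join_upper1 join_upper2 by (simp add: join_least)
  have "s \<otimes> x \<in> join (im V) (im W)" if "s \<in> S" "x \<in> join V W" for s x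
  proof -
    have sc: "s \<in> carrier G" using that S_carrier by blast
    have "x \<in> clo (V \<union> W)" using that by (simp add: join_def)
    then show ?thesis
      by (rule hull_mult_least[rotated 3])
        (use assms that sc imI join_upper1[of "im V" "im W"] join_upper2[of "im W" "im V"] flat_subset in auto)
  qed
  then show "im (join V W) \<subseteq> join (im V) (im W)"
    using assms by (subst im_least) auto
qed

text \<open>\<open>im\<close> preserves joins but maps an intersection only into the intersection of
  the images; this turns the modular law for \<open>d\<close> into an inequality.\<close>

lemma submodular:
  assumes "V \<in> flats" "W \<in> flats"
  shows "bd (join V W) + bd (V \<inter> W) \<le> bd V + bd W"
proof -
  have "im (V \<inter> W) \<subseteq> im V \<inter> im W"
    using assms im_mono[of "V \<inter> W" V] im_mono[of "V \<inter> W" W] by simp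
  then have "d (im (V \<inter> W)) \<le> d (im V \<inter> im W)" using assms by (simp add: d_mono)
  then have "d (im (join V W)) + d (im (V \<inter> W)) \<le> d (im V) + d (im W)"
    using d_join[of "im V" "im W"] assms by (simp add: im_join)
  then show ?thesis using d_join[OF assms] assms by (simp add: d_im)
qed

lemma sat_flat [simp]:
  assumes "V \<in> flats"
  shows "sat V \<in> flats"
  using flat_quotient[OF S_carrier im_flat[OF assms]] by (simp add: sat_def)

lemma subset_sat: "V \<in> flats \<Longrightarrow> V \<subseteq> sat V"
  unfolding sat_def using in_carrier imI by blast

lemma im_sat: "V \<in> flats \<Longrightarrow> im (sat V) = im V"
proof
  assume V: "V \<in> flats"
  then show "im (sat V) \<subseteq> im V" by (simp add: im_least) (simp add: sat_def)
  show "im V \<subseteq> im (sat V)" using V subset_sat by (simp add: im_mono)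
qed

lemma sat_sat: "V \<in> flats \<Longrightarrow> sat (sat V) = sat V"
  using im_sat[of V] by (simp add: sat_def)

lemma sat_mono: "V \<in> flats \<Longrightarrow> W \<in> flats \<Longrightarrow> V \<subseteq> W \<Longrightarrow> sat V \<subseteq> sat W"
  using im_mono[of V W] by (auto simp: sat_def)

lemma sat_least: "V \<in> flats \<Longrightarrow> W \<in> flats \<Longrightarrow> sat W = W \<Longrightarrow> V \<subseteq> W \<Longrightarrow> sat V \<subseteq> W"
  using sat_mono by metis

lemma bd_sat_le: "V \<in> flats \<Longrightarrow> bd (sat V) \<le> bd V"
  using d_mono[OF _ _ subset_sat, of V] by (simp add: bd_def im_sat)

lemma sat_Int: "V \<in> flats \<Longrightarrow> W \<in> flats \<Longrightarrow> sat V = V \<Longrightarrow> sat W = W \<Longrightarrow> sat (V \<inter> W) = V \<inter> W"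
  using sat_mono[of "V \<inter> W" V] sat_mono[of "V \<inter> W" W] subset_sat[of "V \<inter> W"] by simp blast

lemma cellD: "cell V \<Longrightarrow> V \<in> flats" "cell V \<Longrightarrow> V \<noteq> {}" "cell V \<Longrightarrow> sat V = V" "cell V \<Longrightarrow> V \<subseteq> carrier G"
  by (auto simp: cell_def flat_subset)

lemma cell_Int: "cell V \<Longrightarrow> cell W \<Longrightarrow> x \<in> V \<Longrightarrow> x \<in> W \<Longrightarrow> cell (V \<inter> W)"
  by (auto simp: cell_def sat_Int)

lemma cell_sat: "V \<in> flats \<Longrightarrow> V \<noteq> {} \<Longrightarrow> cell (sat V)"
  using subset_sat[of V] by (auto simp: cell_def sat_sat)

lemma cell_carrier: "cell (carrier G)"
  using subset_sat[OF flat_carrier] flat_subset[OF sat_flat[OF flat_carrier]]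
  by (auto simp: cell_def)

lemma bd_carrier: "bd (carrier G) = 0"
  using d_le_n[of "im (carrier G)"] by (simp add: bd_def)

lemma im_eq_imp: "cell V \<Longrightarrow> W \<in> flats \<Longrightarrow> im W \<subseteq> im V \<Longrightarrow> W \<subseteq> V"
  using subset_sat[of W] cellD(3)[of V] unfolding sat_def by blast

lemma mem_dual:
  assumes "V \<in> flats"
  shows "y \<in> dual V \<longleftrightarrow> y \<in> carrier G \<and> (\<forall>x\<in>V. \<forall>s\<in>S. (s \<otimes> x) \<otimes> y \<in> hyper)"
proof (cases "y \<in> carrier G")
  case True
  have "y \<in> dual V \<longleftrightarrow> im V \<subseteq> {z \<in> carrier G. y \<otimes> z \<in> hyper}"
    using True assms in_carrier[OF im_flat[OF assms]] m_comm[OF True]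
    by (auto simp: dual_def perp_def)
  also have "\<dots> \<longleftrightarrow> (\<forall>x\<in>V. \<forall>s\<in>S. (s \<otimes> x) \<otimes> y \<in> hyper)"
    using assms True in_carrier[OF assms] in_carrier[OF S_flat] m_comm[OF True]
    by (subst im_least) (auto intro: flat_quotient1 hyper)
  finally show ?thesis using True by simp
qed (simp add: dual_def perp_def)

lemma dual_flat [simp]: "V \<in> flats \<Longrightarrow> dual V \<in> flats"
  unfolding dual_def by (simp add: flat_subset)

lemma dual_antimono: "V \<in> flats \<Longrightarrow> W \<in> flats \<Longrightarrow> V \<subseteq> W \<Longrightarrow> dual W \<subseteq> dual V"
  unfolding dual_def by (intro perp_antimono im_mono)

text \<open>The product of \<open>s\<close>, \<open>x\<close> and \<open>y\<close> is symmetric in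
  \<open>x\<close> and \<open>y\<close>. So \<open>y\<close> is in the double dual iff all
  \<open>s \<otimes> y\<close> lie in \<open>perp (perp (im V))\<close>, which is
  \<open>im V\<close>.\<close>

lemma dual_dual:
  assumes "V \<in> flats"
  shows "dual (dual V) = sat V"
proof -
  have pp: "perp (dual V) = im V" using assms by (simp add: dual_def perp_perp)
  have "y \<in> dual (dual V) \<longleftrightarrow> y \<in> sat V" if y: "y \<in> carrier G" for y
  proof -
    have eq: "(s \<otimes> z) \<otimes> y = z \<otimes> (s \<otimes> y)" if "s \<in> S" "z \<in> dual V" for s z
      using that y in_carrier[OF S_flat] in_carrier[OF dual_flat[OF assms]] by (simp add: m_ac)
    have "y \<in> dual (dual V) \<longleftrightarrow> (\<forall>z\<in>dual V. \<forall>s\<in>S. z \<otimes> (s \<otimes> y) \<in> hyper)"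
      using y assms eq by (auto simp: mem_dual)
    also have "\<dots> \<longleftrightarrow> (\<forall>s\<in>S. s \<otimes> y \<in> perp (dual V))"
      using y in_carrier[OF S_flat] by (auto simp: perp_def)
    finally show ?thesis using y by (simp add: pp sat_def)
  qed
  then show ?thesis using flat_subset[of "dual (dual V)"] flat_subset[of "sat V"] assms by auto
qed

lemma d_dual: "V \<in> flats \<Longrightarrow> d (dual V) + d (im V) = n"
  by (simp add: dual_def d_perp)

lemma d_im_dual: "V \<in> flats \<Longrightarrow> sat V = V \<Longrightarrow> d (im (dual V)) + d V = n"
  using d_dual[of "dual V"] by (simp add: dual_dual)

lemma bd_dual: "V \<in> flats \<Longrightarrow> sat V = V \<Longrightarrow> bd (dual V) = bd V"
  using d_im_dual[of V] d_dual[of V] by (simp add: bd_def)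

lemma sat_dual: "V \<in> flats \<Longrightarrow> sat (dual V) = dual V"
  using dual_dual[of "dual V"] by (simp add: dual_dual) (simp add: dual_def im_sat)

lemma dual_empty_iff:
  assumes "V \<in> flats"
  shows "dual V = {} \<longleftrightarrow> im V = carrier G"
proof
  assume "dual V = {}"
  then have "im V = perp {}" using perp_perp[OF im_flat[OF assms]] by (simp add: dual_def)
  then show "im V = carrier G" by (simp add: perp_def)
qed (simp add: dual_def perp_carrier)

text \<open>The carrier is the only cell with empty dual, and its boundary is 0.\<close>

lemma cell_dual: "cell V \<Longrightarrow> bd V \<noteq> 0 \<Longrightarrow> cell (dual V)"
proof -
  assume V: "cell V" "bd V \<noteq> 0"
  have "dual V \<noteq> {}"
  proof
    assume "dual V = {}"
    then have "im (carrier G) \<subseteq> im V"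
      using dual_empty_iff[of V] V cellD flat_subset[OF im_flat[OF flat_carrier]] by simp
    then have "V = carrier G" using im_eq_imp[OF V(1), of "carrier G"] cellD(4)[OF V(1)] by auto
    then show False using V bd_carrier by simp
  qed
  then show ?thesis using V by (simp add: cell_def sat_dual)
qed

lemma im_translate: "u \<in> carrier G \<Longrightarrow> V \<in> flats \<Longrightarrow> im (u <# V) = u <# im V"
  unfolding im_def by (simp add: mul_translate flat_subset)

lemma bd_translate: "u \<in> carrier G \<Longrightarrow> V \<in> flats \<Longrightarrow> bd (u <# V) = bd V"
  by (simp add: bd_def im_translate d_translate)

lemma sat_translate:
  assumes "u \<in> carrier G" "V \<in> flats"
  shows "sat (u <# V) = u <# sat V"
proof -
  have "s \<otimes> y \<in> u <# im V \<longleftrightarrow> s \<otimes> (inv u \<otimes> y) \<in> im V" if "y \<in> carrier G" "s \<in> S" for y s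
    using that assms in_carrier[OF S_flat that(2)] flat_subset[OF im_flat[OF assms(2)]]
    by (simp add: mem_l_coset m_lcomm)
  then show ?thesis
    using assms flat_subset[OF sat_flat[OF assms(2)]]
    by (auto simp: mem_l_coset im_translate sat_def)
qed

lemma cell_translate: "u \<in> carrier G \<Longrightarrow> cell V \<Longrightarrow> cell (u <# V)"
  unfolding cell_def using l_coset_cancel(1)[of u V] flat_subset[of V]
  by (auto simp: sat_translate flat_translate) (simp add: l_coset_def)

lemma stable_im: "V \<in> flats \<Longrightarrow> H \<subseteq> carrier G \<Longrightarrow> stable H V \<Longrightarrow> stable H (im V)"
  unfolding im_def by (rule stable_mul) (simp_all add: flat_subset)

lemma stable_dual:
  assumes "V \<in> flats" "H \<subseteq> carrier G" "stable H V"
  shows "stable H (dual V)"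
  unfolding stable_def
proof (intro ballI)
  fix h y assume h: "h \<in> H" and y: "y \<in> dual V"
  have hc: "h \<in> carrier G" "y \<in> carrier G" using h y assms in_carrier[of "dual V"] by auto
  have "(s \<otimes> x) \<otimes> (h \<otimes> y) \<in> hyper" if "x \<in> V" "s \<in> S" for x s
  proof -
    have "(s \<otimes> x) \<otimes> (h \<otimes> y) = (s \<otimes> (h \<otimes> x)) \<otimes> y"
      using that hc in_carrier[OF S_flat] in_carrier[OF assms(1)] by (simp add: m_ac)
    then show ?thesis using y that h assms by (auto simp: mem_dual stable_def)
  qed
  then show "h \<otimes> y \<in> dual V" using hc assms by (simp add: mem_dual)
qed

lemma subgroup_cell_subset:
  assumes "flat_subgroup H" "stable H V" "V \<in> flats" "u \<in> V"
  shows "u <# H \<subseteq> V"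
  using assms coset_subset_stable flat_subgroupD(5) flat_subset by blast

end

lemma (in flat_group) coset_eq:
  assumes "flat_subgroup H" "z \<in> carrier G" "x \<in> z <# H"
  shows "x <# H = z <# H"
proof (rule flat_eqI)
  note cs = coset_stable[OF assms(1,2)]
  have xc: "x \<in> carrier G" using assms(3) cs(2) in_carrier by blast
  show "x <# H \<in> flats" "z <# H \<in> flats" using coset_stable(2)[OF assms(1)] xc assms(2) by simp_all
  show "x <# H \<subseteq> z <# H"
    using coset_subset_stable[OF flat_subgroupD(5)[OF assms(1)] cs(1) flat_subset[OF cs(2)] assms(3)] .
  show "d (z <# H) \<le> d (x <# H)" using coset_stable(4)[OF assms(1)] xc assms(2) by simp
qed

section \<open>Cells that are subgroups\<close>

context flat_group_base
begin

text \<open>Stability is demanded for all boundaries up to \<open>l\<close>, so the groups of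
  increasing boundaries form a descending chain.\<close>

definition cell_group :: "nat \<Rightarrow> 'a set \<Rightarrow> bool" where
  "cell_group l N \<longleftrightarrow> flat_subgroup N \<and> cell N \<and> bd N = l \<and> (\<forall>W. cell W \<longrightarrow> bd W \<le> l \<longrightarrow> stable N W)"

lemma cell_groupD:
  assumes "cell_group l N"
  shows "flat_subgroup N" "cell N" "bd N = l" "\<And>W. cell W \<Longrightarrow> bd W \<le> l \<Longrightarrow> stable N W"
  using assms by (auto simp: cell_group_def)

text \<open>\<open>im N\<close> is \<open>N\<close>-stable, whence the divisibility, and contains
  \<open>S\<close> because \<open>\<one> \<in> N\<close>, whence the lower bound on
  \<open>d N\<close>.\<close>

lemma cell_group_dims:
  assumes "cell_group l N"
  shows "d (im N) = l + d N" "d N dvd l" "d S \<le> l + d N"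
proof -
  note N = cell_groupD[OF assms] and H = flat_subgroupD[OF cell_groupD(1)[OF assms]]
  show dim: "d (im N) = l + d N" using d_im[OF H(1)] N(3) by simp
  have "d N dvd d (im N)" using d_dvd[OF N(1)] stable_im[OF H(1,2,4)] H(1) by simp
  then show "d N dvd l" using dim by (simp add: dvd_add_left_iff)
  have "S \<subseteq> im N"
  proof
    fix s assume "s \<in> S"
    then show "s \<in> im N" using imI[OF H(1,3), of s] in_carrier[OF S_flat] by simp
  qed
  then show "d S \<le> l + d N" using d_mono[of S "im N"] H(1) dim by simp
qed

lemma cell_group_coset:
  assumes "cell_group l N" "x \<in> carrier G"
  shows "cell (x <# N)" "bd (x <# N) = l" "d (x <# N) = d N" "x \<in> x <# N" "d (im (x <# N)) = l + d N"
proof -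
  note N = cell_groupD[OF assms(1)]
  show "cell (x <# N)" "bd (x <# N) = l" "d (x <# N) = d N" "x \<in> x <# N"
    using N assms cell_translate bd_translate cellD(1) coset_stable by auto
  then show "d (im (x <# N)) = l + d N" using d_im cellD(1) by (metis add.commute)
qed

text \<open>Translate \<open>N\<close> to contain \<open>\<one>\<close>. Absorption for
  \<open>inv x <# W\<close> then shows that \<open>x <# N'\<close> stays in \<open>W\<close>
  whenever \<open>x \<in> W\<close> and \<open>W\<close> is a cell of boundary at most
  \<open>l\<close>. For \<open>W = N'\<close> this is closure under multiplication, for general
  \<open>W\<close> it is stability.\<close>

lemma cell_group_of_absorbing:
  assumes N: "cell N" "bd N = l" and abs: "\<And>W. cell W \<Longrightarrow> bd W \<le> l \<Longrightarrow> N \<inter> W \<noteq> {} \<Longrightarrow> N \<subseteq> W"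
  shows "\<exists>N'. cell_group l N'"
proof -
  obtain u where u: "u \<in> N" using cellD(2)[OF N(1)] by blast
  have uc: "u \<in> carrier G" using u cellD(4)[OF N(1)] by blast
  define N' where "N' = inv u <# N"
  have N': "cell N'" "bd N' = l" "N' \<in> flats"
    using N uc cell_translate bd_translate cellD(1) unfolding N'_def by auto
  have one: "\<one> \<in> N'" using u uc cellD(4)[OF N(1)] by (simp add: N'_def mem_l_coset)
  have abs': "N' \<subseteq> W" if W: "cell W" "bd W \<le> l" "\<one> \<in> W" for W
  proof -
    have "u \<in> u <# W" using W(3) uc cellD(4)[OF W(1)] by (simp add: mem_l_coset)
    then have "N \<subseteq> u <# W"
      using abs[of "u <# W"] cell_translate[OF uc W(1)] bd_translate[OF uc cellD(1)[OF W(1)]] W(2) u by auto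
    then have "N' \<subseteq> inv u <# (u <# W)" unfolding N'_def by (rule l_coset_mono)
    then show ?thesis using l_coset_cancel uc cellD(4)[OF W(1)] by simp
  qed
  have tr: "x \<otimes> h \<in> W" if W: "cell W" "bd W \<le> l" and "x \<in> W" "h \<in> N'" for W x h
  proof -
    have xc: "x \<in> carrier G" using that cellD(4) by blast
    have hc: "h \<in> carrier G" using that in_carrier N'(3) by blast
    have "\<one> \<in> inv x <# W" using that xc cellD(4)[OF W(1)] by (simp add: mem_l_coset)
    then have "N' \<subseteq> inv x <# W"
      using abs'[of "inv x <# W"] cell_translate W bd_translate cellD(1)[OF W(1)] xc by simp
    then show ?thesis using that(4) xc hc cellD(4)[OF W(1)] by (auto simp: mem_l_coset)
  qed
  have sub: "subgroup N' G"
  proof (rule subgroupI)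
    show "N' \<subseteq> carrier G" using N'(3) flat_subset by simp
    show "N' \<noteq> {}" using one by auto
    fix x y assume x: "x \<in> N'" and y: "y \<in> N'"
    show "x \<otimes> y \<in> N'" using tr[OF N'(1)] N'(2) x y by simp
  next
    fix x assume x: "x \<in> N'"
    have xc: "x \<in> carrier G" using x in_carrier N'(3) by blast
    \<comment> \<open>Equal dimensions turn the inclusion into an equality, and
      \<open>\<one> \<in> x <# N'\<close> then yields the inverse.\<close>
    have "x <# N' \<subseteq> N'" using tr[OF N'(1)] N'(2) x by (auto simp: l_coset_def)
    then have "x <# N' = N'"
      using flat_eqI[of "x <# N'" N'] flat_translate d_translate xc N'(3) by simp
    then show "inv x \<in> N'" using one xc N'(3) flat_subset mem_l_coset[of x N' \<one>] by auto
  qed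
  have "stable N' W" if W: "cell W" "bd W \<le> l" for W
    using tr[OF W] cellD(4)[OF W(1)] in_carrier[OF N'(3)] by (auto simp: stable_def) (metis m_comm subsetD)
  then show ?thesis using sub N' by (auto simp: cell_group_def flat_subgroup_def)
qed

lemma exists_minimal_cell:
  assumes "cell V" "bd V = l"
  obtains N where "cell N" "bd N = l" "\<And>W. cell W \<Longrightarrow> bd W = l \<Longrightarrow> d N \<le> d W"
proof -
  have "cell V \<and> bd V = l" using assms by simp
  then have "\<exists>N. (cell N \<and> bd N = l) \<and> (\<forall>W. cell W \<and> bd W = l \<longrightarrow> d N \<le> d W)"
    by (rule ex_has_least_nat)
  then show ?thesis using that by blast
qed

text \<open>No boundary lies below 0, so submodularity alone keeps the intersection at boundary
  0.\<close>

lemma cell_group_0: "\<exists>N. cell_group 0 N"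
proof -
  obtain N where N: "cell N" "bd N = 0" and min: "\<And>W. cell W \<Longrightarrow> bd W = 0 \<Longrightarrow> d N \<le> d W"
    using exists_minimal_cell[OF cell_carrier bd_carrier] by metis
  show ?thesis
  proof (rule cell_group_of_absorbing[OF N])
    fix W assume W: "cell W" "bd W \<le> 0" "N \<inter> W \<noteq> {}"
    have "cell (N \<inter> W)" using cell_Int[OF N(1) W(1)] W(3) by blast
    moreover have "bd (N \<inter> W) = 0" using submodular[of N W] N W cellD(1) by simp
    ultimately have "d N \<le> d (N \<inter> W)" by (rule min)
    then have "N \<inter> W = N" using flat_eqI[of "N \<inter> W" N] N W cellD(1) by simp
    then show "N \<subseteq> W" by blast
  qed
qed

text \<open>An intersection of too large a boundary pushes the boundary of the join down. Its
  saturation \<open>J\<close> is then a cell about which the smaller boundaries give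
  information.\<close>

lemma join_cell:
  assumes "cell Y" "cell W" "bd Y < bd (Y \<inter> W)"
  obtains J where "cell J" "bd J < bd W" "Y \<subseteq> J" "W \<subseteq> J"
    "\<And>Z. cell Z \<Longrightarrow> Y \<subseteq> Z \<Longrightarrow> W \<subseteq> Z \<Longrightarrow> J \<subseteq> Z"
    "d (im J) + d (Y \<inter> W) < bd W + d Y + d W"
proof
  let ?U = "join Y W"
  note Y = cellD[OF assms(1)] and W = cellD[OF assms(2)]
  have U: "?U \<in> flats" using Y W by simp
  have bdU: "bd ?U < bd W" using submodular[OF Y(1) W(1)] assms(3) by simp
  show "cell (sat ?U)" using cell_sat[OF U] Y(2) join_upper1[of Y W] by blast
  show "bd (sat ?U) < bd W" using bd_sat_le[OF U] bdU by simp
  show "Y \<subseteq> sat ?U" "W \<subseteq> sat ?U"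
    using subset_sat[OF U] join_upper1[of Y W] join_upper2[of W Y] by blast+
  show "sat ?U \<subseteq> Z" if "cell Z" "Y \<subseteq> Z" "W \<subseteq> Z" for Z
    using sat_least[OF U] that cellD join_least by simp
  show "d (im (sat ?U)) + d (Y \<inter> W) < bd W + d Y + d W"
    using im_sat[OF U] d_im[OF U] d_join[OF Y(1) W(1)] bdU by simp
qed

end

text \<open>
  The induction step: \<open>k\<close> is the largest boundary below \<open>l\<close> of a cell. By \<open>l_le\<close> and \<open>d S \<le> d (im M) = k + d M\<close>,
  \<open>l\<close> lies strictly between two multiples of \<open>d M\<close>, so no cell of boundary \<open>l\<close> is a union of cosets of \<open>M\<close>.
\<close>

locale flat_group_step = flat_group_base +
  fixes l k :: nat and M :: "'a set"
  assumes l_le: "l + 2 \<le> d S" and k_less: "k < l" and M: "cell_group k M"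
    and gap: "\<And>W. cell W \<Longrightarrow> bd W < l \<Longrightarrow> bd W \<le> k"
begin

lemmas Md = flat_subgroupD[OF cell_groupD(1)[OF M]]

lemma low_stable: "cell W \<Longrightarrow> bd W < l \<Longrightarrow> stable M W"
  using gap cell_groupD(4)[OF M] by blast

lemma low_coset: "cell W \<Longrightarrow> bd W < l \<Longrightarrow> x \<in> W \<Longrightarrow> x <# M \<subseteq> W"
  using low_stable cellD(1) subgroup_cell_subset cell_groupD(1)[OF M] by blast

lemma not_stable:
  assumes "cell Y" "bd Y = l"
  shows "\<not> stable M Y"
proof
  assume st: "stable M Y"
  note Y = cellD[OF assms(1)]
  have "d M dvd d Y" "d M dvd d (im Y)"
    using d_dvd[OF cell_groupD(1)[OF M]] st stable_im[OF Y(1) Md(2) st] Y(1) by simp_all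
  then have "d M dvd l" using d_im[OF Y(1)] assms(2) by (simp add: dvd_add_right_iff)
  then have "d M dvd l - k" using cell_group_dims(2)[OF M] by (simp add: dvd_diff_nat)
  then have "d M \<le> l - k" using k_less by (simp add: dvd_imp_le)
  then show False using cell_group_dims(3)[OF M] l_le k_less by simp
qed

lemma exists_bad:
  assumes "cell Y" "bd Y = l"
  obtains x where "x \<in> Y" "x \<in> carrier G" "\<not> x <# M \<subseteq> Y"
proof -
  have "\<exists>x\<in>Y. \<not> x <# M \<subseteq> Y"
  proof (rule ccontr)
    assume "\<not> (\<exists>x\<in>Y. \<not> x <# M \<subseteq> Y)"
    then have "x \<otimes> m \<in> Y" if "x \<in> Y" "m \<in> M" for x m using that by (auto simp: l_coset_def)
    then have "stable M Y"
      using Md(2) cellD(4)[OF assms(1)] m_comm unfolding stable_def by (metis subsetD)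
    then show False using not_stable assms by blast
  qed
  then show ?thesis using that cellD(4)[OF assms(1)] by blast
qed

text \<open>
  Cells of boundary \<open>l\<close> are pushed from a coset of \<open>N\<close> into a coset of the next smaller group \<open>M'\<close>.
  Otherwise the saturation of \<open>Y\<close> and a coset of \<open>M'\<close> is a coset of \<open>N\<close>, that of \<open>dual Y\<close> and a coset
  of \<open>M'\<close> is everything, and counting forces \<open>im N = im M'\<close>.
\<close>

lemma descend:
  assumes N: "cell_group \<nu> N" and M': "cell_group \<mu> M'" and "\<nu> < \<mu>" "\<mu> < l"
    and gap': "\<And>W. cell W \<Longrightarrow> bd W < \<mu> \<Longrightarrow> bd W \<le> \<nu>"
    and Y: "cell Y" "bd Y = l" "z \<in> carrier G" "Y \<subseteq> z <# N"
  shows "\<exists>Z z. cell Z \<and> bd Z = l \<and> z \<in> carrier G \<and> Z \<subseteq> z <# M'"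
proof (rule ccontr)
  assume "\<not> ?thesis"
  then have none: "\<not> Z \<subseteq> z <# M'" if "cell Z" "bd Z = l" "z \<in> carrier G" for Z z
    using that by blast
  \<comment> \<open>Boundary below \<open>l\<close> would force \<open>x <# M \<subseteq> Z\<close>
    by \<open>low_coset\<close>, and boundary \<open>l\<close> is ruled out by
    \<open>none\<close>.\<close>
  have meet: "l < bd (Z \<inter> (x <# M'))"
    if Z: "cell Z" "bd Z = l" and x: "x \<in> Z" "x \<in> carrier G" "\<not> x <# M \<subseteq> Z" for Z x
  proof (rule ccontr)
    assume "\<not> ?thesis"
    moreover have c: "cell (Z \<inter> (x <# M'))"
      using cell_Int[OF Z(1) cell_group_coset(1)[OF M' x(2)] x(1) cell_group_coset(4)[OF M' x(2)]] .
    ultimately consider "bd (Z \<inter> (x <# M')) < l" | "bd (Z \<inter> (x <# M')) = l" by linarith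
    then show False
    proof cases
      case 1
      then show False using low_coset[OF c 1, of x] x cell_group_coset(4)[OF M' x(2)] by blast
    next
      case 2
      then show False using none[OF c 2 x(2)] by blast
    qed
  qed
  note Nd = cell_groupD[OF N] and M'd = cell_groupD[OF M']
  note Ns = flat_subgroupD[OF Nd(1)] and M's = flat_subgroupD[OF M'd(1)]
  have stN: "stable M' N" using M'd(4)[OF Nd(2)] Nd(3) assms(3) by simp
  have M'N: "M' \<subseteq> N"
  proof
    fix m assume "m \<in> M'"
    then show "m \<in> N" using stN Ns(3) M's(2) by (auto simp: stable_def dest!: bspec[of M' _ m] bspec[of N _ \<one>])
  qed
  obtain x where x: "x \<in> Y" "x \<in> carrier G" "\<not> x <# M \<subseteq> Y" using exists_bad[OF Y(1,2)] by blast
  have zN: "z <# N = x <# N" using coset_eq[OF Nd(1) Y(3)] Y(4) x(1) by blast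
  note cx = cell_group_coset[OF M' x(2)] and cN = cell_group_coset[OF N x(2)]
  obtain J where J: "cell J" "bd J < \<mu>" "Y \<subseteq> J" "\<And>Z. cell Z \<Longrightarrow> Y \<subseteq> Z \<Longrightarrow> x <# M' \<subseteq> Z \<Longrightarrow> J \<subseteq> Z"
    "d (im J) + d (Y \<inter> (x <# M')) < \<mu> + d Y + d M'"
    using join_cell[OF Y(1) cx(1)] meet[OF Y(1,2) x] Y(2) cx(2,3) by metis
  \<comment> \<open>\<open>J\<close> lies in the coset because it is the least cell above
    \<open>Y\<close> and \<open>x <# M'\<close>. Conversely its boundary is below \<mu>, hence at
    most \<nu>, so it is \<open>N\<close>-stable.\<close>
  have "J \<subseteq> x <# N" using J(4)[OF cN(1)] Y(4) zN l_coset_mono[OF M'N] by simp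
  moreover have "x <# N \<subseteq> J"
    using subgroup_cell_subset[OF Nd(1) Nd(4)[OF J(1)] cellD(1)[OF J(1)]] gap'[OF J(1,2)] J(3) x(1) by blast
  ultimately have "J = x <# N" by blast
  then have dJ: "d (im J) = \<nu> + d N" using cN by simp
  have R: "0 < d (Y \<inter> (x <# M'))"
    using x(1) cx(4) cellD(1)[OF Y(1)] cellD(1)[OF cx(1)] by (intro d_pos) auto
  let ?Y = "dual Y"
  have Y': "cell ?Y" "bd ?Y = l"
    using cell_dual[OF Y(1)] bd_dual cellD[OF Y(1)] Y(2) assms(4) by simp_all
  obtain x' where x': "x' \<in> ?Y" "x' \<in> carrier G" "\<not> x' <# M \<subseteq> ?Y" using exists_bad[OF Y'] by blast
  note cx' = cell_group_coset[OF M' x'(2)]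
  obtain J' where J': "cell J'" "bd J' < \<mu>" "?Y \<subseteq> J'"
    "d (im J') + d (?Y \<inter> (x' <# M')) < \<mu> + d ?Y + d M'"
    using join_cell[OF Y'(1) cx'(1)] meet[OF Y' x'] Y'(2) cx'(2,3) by metis
  have R': "0 < d (?Y \<inter> (x' <# M'))"
    using x'(1) cx'(4) cellD(1)[OF Y'(1)] cellD(1)[OF cx'(1)] by (intro d_pos) auto
  have "stable N J'" using Nd(4)[OF J'(1)] gap'[OF J'(1,2)] .
  then have st: "stable N (dual J')" using stable_dual cellD(1)[OF J'(1)] Ns(2) by blast
  have sub: "dual J' \<subseteq> Y"
    using dual_antimono[OF _ _ J'(3)] cellD[OF J'(1)] cellD[OF Y'(1)] cellD[OF Y(1)] dual_dual[of Y] by simp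
  \<comment> \<open>This flat is \<open>N\<close>-stable inside \<open>Y\<close>. A point of it
    would put a whole coset of \<open>N\<close> into \<open>Y\<close>, so \<open>Y\<close> would be
    a coset and have boundary \<nu> instead of \<open>l\<close>.\<close>
  have "dual J' = {}"
  proof (rule ccontr)
    assume "dual J' \<noteq> {}"
    then obtain w where w: "w \<in> dual J'" by blast
    have "w <# N \<subseteq> Y" using subgroup_cell_subset[OF Nd(1) st _ w] cellD(1)[OF J'(1)] sub by auto
    moreover have "w <# N = z <# N" using coset_eq[OF Nd(1) Y(3)] Y(4) w sub by blast
    ultimately have "Y = x <# N" using Y(4) zN by blast
    then show False using cN(2) Y(2) assms(3,4) by simp
  qed
  then have "d (im J') = n" using dual_empty_iff cellD(1)[OF J'(1)] by simp
  moreover have "d ?Y + (d Y + l) = n" using d_dual d_im cellD(1)[OF Y(1)] Y(2) by metis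
  ultimately have small: "d Y + l + 1 < \<mu> + d M'" using J'(4) R' by linarith
  have E: "\<nu> + d N + 1 < \<mu> + d Y + d M'" using J(5) dJ R by linarith
  have "d M' dvd \<nu> + d N"
    using d_dvd[OF M'd(1)] stable_im[OF Ns(1) M's(2) stN] Ns(1) cell_group_dims(1)[OF N] by (metis im_flat)
  then have dv: "d M' dvd \<nu> + d N - \<mu>" using cell_group_dims(2)[OF M'] by (simp add: dvd_diff_nat)
  have pos: "\<mu> < \<nu> + d N" using cell_group_dims(3)[OF N] l_le assms(4) by linarith
  obtain c where c: "\<nu> + d N - \<mu> = d M' * c" using dv by (auto elim: dvdE)
  \<comment> \<open>\<open>E\<close> and \<open>small\<close> leave less than two copies of
    \<open>d M'\<close> between \<mu> and \<open>d (im N)\<close>; \<open>pos\<close> leaves at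
    least one. So \<open>N\<close> and \<open>M'\<close> have the same image and, being saturated,
    coincide, although their boundaries differ.\<close>
  have "d M' * c < d M' * 2" using c E small assms(4) by linarith
  then have "c < 2" by simp
  then have "c = 1" using c pos by (cases c) auto
  then have "\<nu> + d N = \<mu> + d M'" using c pos by simp
  then have "im M' = im N"
    using flat_eqI[OF _ _ im_mono[OF M's(1) Ns(1) M'N]] cell_group_dims(1)[OF N] cell_group_dims(1)[OF M'] M's(1) Ns(1) by simp
  then have "N \<subseteq> M'" using im_eq_imp[OF M'd(2) Ns(1)] by simp
  then show False using M'N Nd(3) M'd(3) assms(3) by auto
qed

end

text \<open>A smallest cell of boundary \<open>l\<close>, moved to contain \<open>\<one>\<close>.
  \<open>N_less\<close> is what \<open>descend\<close> is for: a cell of boundary \<open>l\<close>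
  inside a coset of \<open>M\<close> is a proper part of it, since the coset has boundary
  \<open>k\<close>.\<close>

locale flat_group_minimal = flat_group_step +
  fixes N :: "'a set"
  assumes N: "cell N" "bd N = l" and N_min: "\<And>W. cell W \<Longrightarrow> bd W = l \<Longrightarrow> d N \<le> d W"
    and N_less: "d N < d M" and one_N: "\<one> \<in> N"
begin

lemmas Nc = cellD[OF N(1)]

lemma N_subset_M: "N \<subseteq> M"
proof -
  note cM = cell_groupD(2,3)[OF M]
  have c: "cell (N \<inter> M)" using cell_Int[OF N(1) cM(1) one_N Md(3)] .
  consider "bd (N \<inter> M) < l" | "bd (N \<inter> M) = l" | "bd N < bd (N \<inter> M)" using N(2) by linarith
  then show ?thesis
  proof cases
    case 1
    then have "\<one> <# M \<subseteq> N" using low_coset[OF c 1, of \<one>] one_N Md(3) by blast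
    then have "d M \<le> d N" using d_mono[OF _ Nc(1)] Md(1) flat_translate d_translate by (metis one_closed)
    then show ?thesis using N_less by simp
  next
    case 2
    then have "N \<inter> M = N" using N_min[OF c] flat_eqI[of "N \<inter> M" N] Nc(1) Md(1) by simp
    then show ?thesis by blast
  next
    case 3
    then obtain J where J: "cell J" "bd J < bd M" "N \<subseteq> J" "M \<subseteq> J"
      "d (im J) + d (N \<inter> M) < bd M + d N + d M"
      using join_cell[OF N(1) cM(1)] by metis
    have "stable M J" using low_stable[OF J(1)] J(2) cM(2) k_less by simp
    then have "d M dvd d (im J)"
      using d_dvd[OF cell_groupD(1)[OF M]] stable_im[OF cellD(1)[OF J(1)] Md(2)] cellD(1)[OF J(1)] by simp
    then have dv: "d M dvd d (im J) - k" using cell_group_dims(2)[OF M] by (simp add: dvd_diff_nat)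
    have ge: "k + d M \<le> d (im J)"
      using d_mono[OF _ _ im_mono[OF Md(1) cellD(1)[OF J(1)] J(4)]] cell_group_dims(1)[OF M] Md(1) cellD(1)[OF J(1)] by simp
    \<comment> \<open>\<open>d (im J) - k\<close> is a multiple of \<open>d M\<close>, at least one
      copy and less than two. Hence \<open>J\<close> has the image of \<open>M\<close> and lies in
      \<open>M\<close>.\<close>
    have "d (im J) < k + d M * 2" using J(5) cM(2) N_less by linarith
    moreover obtain c where c: "d (im J) - k = d M * c" using dv by (auto elim: dvdE)
    ultimately have "d M * c < d M * 2" using ge by linarith
    then have "c < 2" by simp
    moreover have "0 < c" using c ge Md(6) by (cases c) auto
    ultimately have "d (im J) = k + d M" using c ge by (cases "c = 1") auto
    then have "im M = im J"
      using flat_eqI[OF _ _ im_mono[OF Md(1) cellD(1)[OF J(1)] J(4)]] cell_group_dims(1)[OF M] Md(1) cellD(1)[OF J(1)] by simp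
    then show ?thesis using im_eq_imp[OF cM(1) cellD(1)[OF J(1)]] J(3) by simp
  qed
qed

lemma coset_N_subset:
  assumes "stable M V" "V \<in> flats" "y \<in> V"
  shows "y <# N \<subseteq> V"
  using subgroup_cell_subset[OF cell_groupD(1)[OF M] assms] l_coset_mono[OF N_subset_M, of y] by blast

lemma coset_N_Int:
  assumes "stable M V" "V \<in> flats" "y \<in> carrier G" "y \<notin> V"
  shows "(y <# N) \<inter> V = {}"
  using coset_Int_stable[OF Md(5) assms(1) flat_subset[OF assms(2)] assms(3,4)]
    l_coset_mono[OF N_subset_M, of y] by blast

text \<open>\<open>E\<close> joins to \<open>dual M\<close> a coset of \<open>M\<close> through a
  point of \<open>dual N\<close>. If \<open>E\<close> contains \<open>dual N\<close>, the part of
  \<open>dual N\<close> in that coset is at least as large as \<open>N\<close> by minimality.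
  Otherwise \<open>dual N\<close> has a second point outside \<open>E\<close>, and two translates of
  \<open>N\<close> and \<open>dual M\<close> are independent inside \<open>perp S\<close>, whose
  dimension is at most \<open>n - l - 2\<close>.\<close>

lemma twice_N: "2 * d N + l \<le> d M + k + 1"
proof -
  note cM = cell_groupD(2,3)[OF M]
  have bd0: "bd N \<noteq> 0" using N(2) k_less by simp
  have dN: "d (dual N) + (d N + l) = n" using d_dual d_im Nc(1) N(2) by metis
  have dM: "d (dual M) + (k + d M) = n" using d_dual[OF Md(1)] cell_group_dims(1)[OF M] by simp
  have sub: "dual M \<subseteq> dual N" using dual_antimono[OF Nc(1) Md(1) N_subset_M] .
  have stM: "stable M (dual M)" using stable_dual[OF Md(1,2,4)] .
  have "dual M \<noteq> dual N"
  proof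
    assume "dual M = dual N"
    then have "M = N" using dual_dual Md(1) Nc(1,3) cellD(3)[OF cM(1)] by metis
    then show False using N_less by simp
  qed
  then obtain y where y: "y \<in> dual N" "y \<notin> dual M" using sub by blast
  have yc: "y \<in> carrier G" using y(1) in_carrier dual_flat[OF Nc(1)] by blast
  note cy = cell_group_coset[OF M yc]
  define E where "E = join (y <# M) (dual M)"
  have Ef: "E \<in> flats" using cellD(1)[OF cy(1)] Md(1) by (simp add: E_def)
  have stE: "stable M E"
    unfolding E_def using stable_join[OF cellD(1)[OF cy(1)] dual_flat[OF Md(1)] Md(2)]
      coset_stable(1)[OF cell_groupD(1)[OF M] yc] stM by simp
  have disj: "(y <# M) \<inter> dual M = {}"
    using coset_Int_stable[OF Md(5) stM flat_subset[OF dual_flat[OF Md(1)]] yc y(2)] .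
  have dE: "d E + k = n"
    using d_join[of "y <# M" "dual M"] cellD(1)[OF cy(1)] Md(1) disj cy(3) dM by (simp add: E_def)
  have yE: "y \<in> E" using cy(4) join_upper1[of "y <# M" "dual M"] by (auto simp: E_def)
  have ME: "dual M \<subseteq> E" using join_upper2[of "dual M" "y <# M"] by (auto simp: E_def)
  show ?thesis
  proof (cases "dual N \<subseteq> E")
    case True
    let ?R = "dual N \<inter> (y <# M)"
    have cN: "cell (dual N)" "bd (dual N) = l" using cell_dual[OF N(1) bd0] bd_dual[OF Nc(1,3)] N(2) by simp_all
    have c: "cell ?R" using cell_Int[OF cN(1) cy(1) y(1) cy(4)] .
    have jE: "join (dual N) (y <# M) = E"
    proof
      show "join (dual N) (y <# M) \<subseteq> E"
        using True Ef join_upper1[of "y <# M" "dual M"] by (simp add: join_least E_def)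
      show "E \<subseteq> join (dual N) (y <# M)"
        unfolding E_def using sub join_upper1[of "dual N" "y <# M"] join_upper2[of "y <# M" "dual N"]
          cellD(1)[OF cy(1)] cellD(1)[OF cN(1)] by (subst join_least) auto
    qed
    have dR: "d ?R + d E = d (dual N) + d M"
      using d_join[OF cellD(1)[OF cN(1)] cellD(1)[OF cy(1)]] jE cy(3) by simp
    consider "bd ?R < l" | "bd ?R = l" | "bd (dual N) < bd ?R" using cN(2) by linarith
    then show ?thesis
    proof cases
      case 1
      have "y <# M \<subseteq> ?R" using low_coset[OF c 1, of y] y(1) cy(4) by blast
      then have "d M \<le> d ?R" using d_mono[OF cellD(1)[OF cy(1)] cellD(1)[OF c]] cy(3) by simp
      then show ?thesis using dR dE dN k_less by linarith
    next
      case 2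
      then show ?thesis using N_min[OF c] dR dE dN by linarith
    next
      case 3
      obtain J where J: "cell J" "bd J < bd (y <# M)" "dual N \<subseteq> J"
        "d (im J) + d ?R < bd (y <# M) + d (dual N) + d (y <# M)"
        using join_cell[OF cN(1) cy(1) 3] by metis
      have st: "stable M (dual J)"
        using stable_dual[OF cellD(1)[OF J(1)] Md(2) low_stable[OF J(1)]] J(2) cy(2) k_less by simp
      have dJ: "dual J \<subseteq> N"
        using dual_antimono[OF _ _ J(3)] cellD(1)[OF J(1)] cellD(1)[OF cN(1)] dual_dual[OF Nc(1)] Nc(3) by simp
      have "dual J = {}"
      proof (rule ccontr)
        assume "dual J \<noteq> {}"
        then obtain w where w: "w \<in> dual J" by blast
        then have "w <# M \<subseteq> N"
          using subgroup_cell_subset[OF cell_groupD(1)[OF M] st _ w] cellD(1)[OF J(1)] dJ by auto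
        moreover have "w \<in> carrier G" using w dJ Nc(4) by blast
        ultimately have "d M \<le> d N" using d_mono[OF _ Nc(1)] cell_group_coset[OF M] cellD(1) by metis
        then show False using N_less by simp
      qed
      then have "d (im J) = n" using dual_empty_iff cellD(1)[OF J(1)] by simp
      then show ?thesis using J(4) dR dE cy(2,3) by linarith
    qed
  next
    case False
    then obtain z where z: "z \<in> dual N" "z \<notin> E" by blast
    have zc: "z \<in> carrier G" using z(1) in_carrier dual_flat[OF Nc(1)] by blast
    have f: "y <# N \<in> flats" "z <# N \<in> flats" "d (y <# N) = d N" "d (z <# N) = d N"
      using yc zc Nc(1) flat_translate d_translate by simp_all
    let ?A = "join (y <# N) (dual M)"
    have "(y <# N) \<inter> dual M = {}" using coset_N_Int[OF stM _ yc y(2)] Md(1) by simp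
    then have dA: "d ?A = d N + d (dual M)" using d_join[OF f(1) dual_flat[OF Md(1)]] f(3) by simp
    have "?A \<subseteq> E" using coset_N_subset[OF stE Ef yE] ME Ef by (simp add: join_least)
    then have "(z <# N) \<inter> ?A = {}" using coset_N_Int[OF stE Ef zc z(2)] by blast
    then have dZ: "d (join (z <# N) ?A) = 2 * d N + d (dual M)"
      using d_join[OF f(2), of ?A] f Md(1) dA by simp
    \<comment> \<open>Commutativity moves the factor from \<open>N\<close> over to
      \<open>S\<close>.\<close>
    have pS: "u <# N \<subseteq> perp S" if u: "u \<in> dual N" "u \<in> carrier G" for u
    proof
      fix v assume "v \<in> u <# N"
      then obtain m where m: "m \<in> N" "v = u \<otimes> m" by (auto simp: l_coset_def)
      have mc: "m \<in> carrier G" using m Nc(4) by blast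
      have "s \<otimes> v \<in> hyper" if "s \<in> S" for s
      proof -
        have "s \<otimes> v = (s \<otimes> m) \<otimes> u" using m(2) mc u(2) in_carrier[OF S_flat that] by (simp add: m_ac)
        then show ?thesis using u(1) m(1) that Nc(1) by (simp add: mem_dual)
      qed
      then show "v \<in> perp S" using m(2) mc u(2) by (simp add: perp_def)
    qed
    have "dual M \<subseteq> perp S"
    proof
      fix v assume v: "v \<in> dual M"
      then have "s \<otimes> \<one> \<otimes> v \<in> hyper" if "s \<in> S" for s
        using that Md(1,3) by (simp add: mem_dual)
      then have "s \<otimes> v \<in> hyper" if "s \<in> S" for s
        using that in_carrier[OF S_flat that] by fastforce
      then show "v \<in> perp S" using in_carrier[OF dual_flat[OF Md(1)] v] by (simp add: perp_def)
    qed
    then have "join (z <# N) ?A \<subseteq> perp S"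
      using pS[OF z(1) zc] pS[OF y(1) yc] f Md(1) S_carrier by (simp add: join_least)
    then have "2 * d N + d (dual M) \<le> d (perp S)"
      using d_mono[of "join (z <# N) ?A" "perp S"] f Md(1) S_carrier dZ by simp
    then show ?thesis using d_perp[OF S_flat] dM l_le by linarith
  qed
qed

text \<open>
  If \<open>N\<close> does not absorb a cell \<open>Y\<close>, then \<open>Y\<close> and \<open>dual Y\<close> exceed
  their cores by less than \<open>d N\<close> each; since these excesses and \<open>l\<close> add up to a multiple of \<open>d M\<close>,
  this contradicts \<open>twice_N\<close>.
\<close>

definition core :: "'a set \<Rightarrow> 'a set" where "core V = {x \<in> V. \<forall>m\<in>M. m \<otimes> x \<in> V}"

lemma core_flat [simp]: "V \<in> flats \<Longrightarrow> core V \<in> flats"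
proof -
  assume V: "V \<in> flats"
  have "core V = V \<inter> {y \<in> carrier G. \<forall>m\<in>M. m \<otimes> y \<in> V}"
    using in_carrier[OF V] by (auto simp: core_def)
  then show ?thesis using flat_quotient[OF Md(2) V] V by simp
qed

lemma core_subset: "core V \<subseteq> V"
  by (auto simp: core_def)

lemma stable_core: "V \<in> flats \<Longrightarrow> stable M (core V)"
  unfolding stable_def
proof (intro ballI)
  fix h x assume V: "V \<in> flats" and h: "h \<in> M" and x: "x \<in> core V"
  have hc: "h \<in> carrier G" "x \<in> carrier G" "x \<in> V"
    using V h x Md(2) in_carrier by (auto simp: core_def)
  have "m \<otimes> (h \<otimes> x) \<in> V" if "m \<in> M" for m
  proof -
    have "m \<otimes> h \<in> M" using that h Md(4) by (simp add: stable_def)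
    then have "(m \<otimes> h) \<otimes> x \<in> V" using x by (simp add: core_def)
    then show ?thesis using hc that Md(2) by (simp add: m_assoc subsetD)
  qed
  then show "h \<otimes> x \<in> core V" using x h by (simp add: core_def)
qed

lemma core_greatest: "W \<subseteq> V \<Longrightarrow> stable M W \<Longrightarrow> W \<subseteq> core V"
  by (auto simp: core_def stable_def)

text \<open>By minimality and \<open>N_less\<close> the partial overlap has boundary above
  \<open>l\<close>, so the join of the translate with \<open>Y\<close> falls below \<open>l\<close>.
  The dual of its saturation is \<open>M\<close>-stable inside \<open>dual Y\<close> and bounds the
  core from below.\<close>

lemma core_dual_defect:
  assumes Y: "cell Y" "bd Y = l" and u: "u \<in> carrier G" "(u <# N) \<inter> Y \<noteq> {}" "\<not> u <# N \<subseteq> Y"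
  shows "d (dual Y) + 1 < d (core (dual Y)) + d N"
proof -
  note Yd = cellD[OF Y(1)]
  have c: "cell (u <# N)" "bd (u <# N) = l" "d (u <# N) = d N"
    using cell_translate[OF u(1) N(1)] bd_translate[OF u(1) Nc(1)] d_translate[OF u(1) Nc(1)] N(2) by simp_all
  let ?R = "(u <# N) \<inter> Y"
  obtain x where x: "x \<in> ?R" using u(2) by blast
  have cR: "cell ?R" using cell_Int[OF c(1) Y(1)] x by blast
  have "bd (u <# N) < bd ?R"
  proof (rule ccontr)
    assume "\<not> ?thesis"
    then consider "bd ?R < l" | "bd ?R = l" using c(2) by linarith
    then show False
    proof cases
      case 1
      have xc: "x \<in> carrier G" using x Yd(4) by blast
      have "x <# M \<subseteq> u <# N" using low_coset[OF cR 1 x] by blast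
      then have "d (x <# M) \<le> d (u <# N)" using cell_group_coset(1)[OF M xc] c(1) cellD(1) by (simp add: d_mono)
      then show False using cell_group_coset(3)[OF M xc] c(3) N_less by simp
    next
      case 2
      then have "?R = u <# N" using N_min[OF cR] flat_eqI[of ?R "u <# N"] cellD(1) cR c by simp
      then show False using u(3) by blast
    qed
  qed
  then obtain J where J: "cell J" "bd J < bd Y" "Y \<subseteq> J" "d (im J) + d ?R < bd Y + d (u <# N) + d Y"
    using join_cell[OF c(1) Y(1)] by metis
  have st: "stable M (dual J)"
    using stable_dual[OF cellD(1)[OF J(1)] Md(2) low_stable[OF J(1)]] J(2) Y(2) by simp
  have "dual J \<subseteq> core (dual Y)"
    using core_greatest[OF _ st] dual_antimono[OF Yd(1) cellD(1)[OF J(1)] J(3)] by simp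
  then have "d (dual J) \<le> d (core (dual Y))" using cellD(1)[OF J(1)] Yd(1) by (simp add: d_mono)
  moreover have "d (dual J) + d (im J) = n" using d_dual cellD(1)[OF J(1)] by simp
  moreover have "d (dual Y) + (d Y + l) = n" using d_dual d_im Yd(1) Y(2) by metis
  moreover have "0 < d ?R" using d_pos cellD(1,2)[OF cR] by simp
  ultimately show ?thesis using J(4) c(3) Y(2) by linarith
qed

lemma absorbing:
  assumes Y: "cell Y" "bd Y \<le> l" and x: "x \<in> N" "x \<in> Y"
  shows "N \<subseteq> Y"
proof (cases "bd Y = l")
  case False
  then have low: "x <# M \<subseteq> Y" using low_coset[OF Y(1) _ x(2)] Y(2) by simp
  have "N \<subseteq> x <# M"
  proof -
    have "x <# M = \<one> <# M"
      using coset_eq[OF cell_groupD(1)[OF M] one_closed, of x] x(1) N_subset_M lcos_mult_one[OF Md(2)] by blast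
    then show ?thesis using N_subset_M lcos_mult_one[OF Md(2)] by simp
  qed
  then show ?thesis using low by blast
next
  case True
  note Yd = cellD[OF Y(1)]
  show ?thesis
  proof (rule ccontr)
    assume notsub: "\<not> N \<subseteq> Y"
    have e: "\<one> <# N = N" using Nc(4) by (rule lcos_mult_one)
    have b1: "d (dual Y) + 1 < d (core (dual Y)) + d N"
      using core_dual_defect[OF Y(1) True one_closed] x notsub by (auto simp: e)
    have Y': "cell (dual Y)" "bd (dual Y) = l"
      using cell_dual[OF Y(1)] bd_dual[OF Yd(1,3)] True k_less by simp_all
    note Yd' = cellD[OF Y'(1)]
    obtain y where y: "y \<in> dual Y" "y \<in> carrier G" "\<not> y <# M \<subseteq> dual Y" using exists_bad[OF Y'] by blast
    have yn: "y \<notin> core (dual Y)"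
      using y subgroup_cell_subset[OF cell_groupD(1)[OF M] stable_core[OF Yd'(1)] core_flat[OF Yd'(1)], of y]
        core_subset[of "dual Y"] by blast
    have f: "y <# N \<in> flats" "d (y <# N) = d N" "y \<in> y <# N"
      using flat_translate d_translate y(2) Nc(1) one_N by (auto simp: l_coset_def intro!: bexI[of _ \<one>])
    \<comment> \<open>\<open>y <# N\<close> is disjoint from the core, and by \<open>b1\<close>
      there is no room for \<open>d N\<close> more dimensions. So \<open>core_dual_defect\<close>
      applies again, to \<open>dual Y\<close>, whose dual is \<open>Y\<close>.\<close>
    have "\<not> y <# N \<subseteq> dual Y"
    proof
      assume "y <# N \<subseteq> dual Y"
      then have "join (y <# N) (core (dual Y)) \<subseteq> dual Y"
        using Yd'(1) core_subset by (simp add: join_least)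
      then have "d (join (y <# N) (core (dual Y))) \<le> d (dual Y)" using f(1) Yd'(1) by (simp add: d_mono)
      moreover have "(y <# N) \<inter> core (dual Y) = {}"
        using coset_N_Int[OF stable_core[OF Yd'(1)] core_flat[OF Yd'(1)] y(2) yn] .
      then have "d (join (y <# N) (core (dual Y))) = d N + d (core (dual Y))"
        using d_join[OF f(1) core_flat[OF Yd'(1)]] f(2) by simp
      ultimately show False using b1 by linarith
    qed
    then have b2: "d Y + 1 < d (core Y) + d N"
      using core_dual_defect[OF Y' y(2)] y(1) f(3) dual_dual[OF Yd(1)] Yd(3) by auto
    have "d (dual Y) + (d Y + l) = n" using d_dual d_im Yd(1) True by metis
    moreover have "d (core Y) \<le> d Y" "d (core (dual Y)) \<le> d (dual Y)"
      using d_mono core_subset Yd(1) Yd'(1) core_flat by auto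
    ultimately have "n - d (core (dual Y)) - d (core Y) = l + (d Y - d (core Y)) + (d (dual Y) - d (core (dual Y)))"
      by linarith
    moreover have "d M dvd n - d (core (dual Y)) - d (core Y)"
    proof -
      have "stable M (carrier G)" using Md(2) by (auto simp: stable_def)
      then show ?thesis
        using d_dvd[OF cell_groupD(1)[OF M]] stable_core Yd(1) Yd'(1) by (simp add: dvd_diff_nat)
    qed
    ultimately have "d M dvd l + (d Y - d (core Y)) + (d (dual Y) - d (core (dual Y)))" by simp
    \<comment> \<open>Subtracting \<open>k\<close>, itself a multiple of \<open>d M\<close>, leaves
      a positive multiple because \<open>k < l\<close>.\<close>
    then have "d M dvd l + (d Y - d (core Y)) + (d (dual Y) - d (core (dual Y))) - k"
      using cell_group_dims(2)[OF M] by (simp add: dvd_diff_nat)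
    then have "d M \<le> l + (d Y - d (core Y)) + (d (dual Y) - d (core (dual Y))) - k"
      using k_less by (intro dvd_imp_le) simp_all
    moreover have "d Y - d (core Y) + 2 \<le> d N" "d (dual Y) - d (core (dual Y)) + 2 \<le> d N"
      using b1 b2 \<open>d (core Y) \<le> d Y\<close> \<open>d (core (dual Y)) \<le> d (dual Y)\<close> by linarith+
    ultimately show False using twice_N k_less by linarith
  qed
qed

end

lemma (in flat_group_step) cell_group_step:
  assumes Y: "cell Y" "bd Y = l" "z \<in> carrier G" "Y \<subseteq> z <# M"
  shows "\<exists>N. cell_group l N"
proof -
  obtain N where N: "cell N" "bd N = l" and min: "\<And>W. cell W \<Longrightarrow> bd W = l \<Longrightarrow> d N \<le> d W"
    using exists_minimal_cell[OF Y(1,2)] by metis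
  note Nd = cellD[OF N(1)] and cz = cell_group_coset[OF M Y(3)]
  obtain u where u: "u \<in> N" using Nd(2) by blast
  have uc: "u \<in> carrier G" using u Nd(4) by blast
  let ?N = "inv u <# N"
  have "Y \<noteq> z <# M" using cz(2) Y(2) k_less by auto
  then have "d Y < d M" using d_psubset[OF cellD(1)[OF Y(1)] cellD(1)[OF cz(1)]] Y(4) cz(3) by auto
  then have less: "d N < d M" using min[OF Y(1,2)] by simp
  have N': "cell ?N" "bd ?N = l" using cell_translate bd_translate N Nd(1) uc by simp_all
  interpret flat_group_minimal G flats d S l k M ?N
  proof
    show "cell ?N" "bd ?N = l" by (fact N')+
    show "d ?N \<le> d W" if "cell W" "bd W = l" for W using min that d_translate uc Nd(1) by simp
    show "d ?N < d M" using less d_translate uc Nd(1) by simp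
    show "\<one> \<in> ?N" using u uc Nd(4) by (simp add: mem_l_coset)
  qed
  show ?thesis
    by (rule cell_group_of_absorbing[OF N']) (use absorbing in blast)
qed

context flat_group_base
begin

text \<open>
  The addition theorem of Balandraud and of Bachoc, Serra and Zemor: one subgroup stabilizes
  all cells of boundary at most \<open>l\<close>.
\<close>

theorem exists_cell_group:
  assumes "cell V" "bd V = l" "l + 2 \<le> d S"
  shows "\<exists>N. cell_group l N"
  using assms
proof (induction l arbitrary: V rule: less_induct)
  case (less l)
  show ?case
  proof (cases "l = 0")
    case True
    then show ?thesis using cell_group_0 by simp
  next
    case False
    define \<Lambda> where "\<Lambda> = {\<mu>. \<mu> < l \<and> (\<exists>W. cell W \<and> bd W = \<mu>)}"
    have fin: "finite \<Lambda>" and zero: "0 \<in> \<Lambda>"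
      using False cell_carrier bd_carrier by (auto simp: \<Lambda>_def)
    have "\<exists>N. cell_group \<mu> N" if "\<mu> \<in> \<Lambda>" for \<mu>
      using that less.IH[of \<mu>] less.prems(3) by (fastforce simp: \<Lambda>_def)
    then obtain N where N: "\<And>\<mu>. \<mu> \<in> \<Lambda> \<Longrightarrow> cell_group \<mu> (N \<mu>)" by metis
    define k where "k = Max \<Lambda>"
    have k: "k \<in> \<Lambda>" unfolding k_def by (rule Max_in) (use fin zero in auto)
    interpret flat_group_step G flats d S l k "N k"
    proof
      show "l + 2 \<le> d S" by fact
      show "k < l" using k by (simp add: \<Lambda>_def)
      show "cell_group k (N k)" using N k by simp
      show "bd W \<le> k" if "cell W" "bd W < l" for W
        using that fin by (auto simp: k_def \<Lambda>_def intro!: Max_ge)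
    qed
    define P where "P \<mu> \<longleftrightarrow> (\<exists>Z z. cell Z \<and> bd Z = l \<and> z \<in> carrier G \<and> Z \<subseteq> z <# N \<mu>)" for \<mu>
    \<comment> \<open>Cosets of \<open>N 0\<close> have boundary 0, so intersecting with one cannot
      raise the boundary, and the choice of \<open>x\<close> prevents it from dropping.\<close>
    have "P 0"
    proof -
      obtain x where x: "x \<in> V" "x \<in> carrier G" "\<not> x <# N k \<subseteq> V"
        using exists_bad[OF less.prems(1,2)] by blast
      note c0 = cell_group_coset[OF N[OF zero] x(2)]
      let ?Z = "V \<inter> (x <# N 0)"
      have cZ: "cell ?Z" using cell_Int[OF less.prems(1) c0(1) x(1) c0(4)] .
      have "bd ?Z \<le> l"
        using submodular[OF cellD(1)[OF less.prems(1)] cellD(1)[OF c0(1)]] c0(2) less.prems(2) by simp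
      moreover have "\<not> bd ?Z < l" using low_coset[OF cZ _, of x] x c0(4) by blast
      ultimately have "bd ?Z = l" by simp
      then show ?thesis using cZ x(2) by (auto simp: P_def)
    qed
    then have ne: "{\<mu> \<in> \<Lambda>. P \<mu>} \<noteq> {}" using zero by auto
    have fin': "finite {\<mu> \<in> \<Lambda>. P \<mu>}" using fin by simp
    \<comment> \<open>The last boundary whose group has a coset containing a cell of boundary
      \<open>l\<close>. Since \<open>descend\<close> reaches the next boundary in \<Lambda>, it must
      be \<open>k\<close>.\<close>
    define \<nu> where "\<nu> = Max {\<mu> \<in> \<Lambda>. P \<mu>}"
    have \<nu>: "\<nu> \<in> \<Lambda>" "P \<nu>" using Max_in[OF fin' ne] by (auto simp: \<nu>_def)
    have "\<nu> = k"
    proof (rule ccontr)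
      assume "\<nu> \<noteq> k"
      then have "\<nu> < k" using Max_ge[OF fin \<nu>(1)] by (simp add: k_def)
      define \<Lambda>' where "\<Lambda>' = {\<mu> \<in> \<Lambda>. \<nu> < \<mu>}"
      have \<Lambda>': "finite \<Lambda>'" "\<Lambda>' \<noteq> {}" using fin k \<open>\<nu> < k\<close> by (auto simp: \<Lambda>'_def)
      define \<mu> where "\<mu> = Min \<Lambda>'"
      have \<mu>: "\<mu> \<in> \<Lambda>" "\<nu> < \<mu>" "\<mu> < l" using Min_in[OF \<Lambda>'] by (auto simp: \<mu>_def \<Lambda>'_def \<Lambda>_def)
      have gap': "bd W \<le> \<nu>" if W: "cell W" "bd W < \<mu>" for W
      proof (rule ccontr)
        assume "\<not> bd W \<le> \<nu>"
        then have "bd W \<in> \<Lambda>'" using W \<mu>(3) by (auto simp: \<Lambda>'_def \<Lambda>_def)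
        then show False using Min_le[OF \<Lambda>'(1), of "bd W"] W(2) by (simp add: \<mu>_def)
      qed
      obtain Z z where Z: "cell Z" "bd Z = l" "z \<in> carrier G" "Z \<subseteq> z <# N \<nu>" using \<nu>(2) by (auto simp: P_def)
      have "P \<mu>"
        unfolding P_def using descend[OF N[OF \<nu>(1)] N[OF \<mu>(1)] \<mu>(2,3) gap' Z] .
      then have "\<mu> \<le> \<nu>" unfolding \<nu>_def using fin' \<mu>(1) by (intro Max_ge) simp_all
      then show False using \<mu>(2) by simp
    qed
    then show ?thesis using cell_group_step \<nu>(2) by (auto simp: P_def)
  qed
qed

end

context flat_group
begin

section \<open>Kneser's theorem\<close>

definition stabilizer :: "'a set \<Rightarrow> 'a set" where
  "stabilizer V = {h \<in> carrier G. \<forall>x\<in>V. x \<otimes> h \<in> V}"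

lemma stabilizer:
  assumes "V \<in> flats" "V \<noteq> {}"
  shows "flat_subgroup (stabilizer V)" "stable (stabilizer V) V"
    "\<And>H. H \<subseteq> carrier G \<Longrightarrow> stable H V \<Longrightarrow> H \<subseteq> stabilizer V"
proof -
  have f: "stabilizer V \<in> flats" unfolding stabilizer_def using flat_quotient assms flat_subset by blast
  have one: "\<one> \<in> stabilizer V" using in_carrier[OF assms(1)] by (simp add: stabilizer_def)
  show "stable (stabilizer V) V"
    using in_carrier[OF assms(1)] m_comm by (auto simp: stabilizer_def stable_def) 
  show "H \<subseteq> stabilizer V" if "H \<subseteq> carrier G" "stable H V" for H
    using that in_carrier[OF assms(1)] m_comm by (fastforce simp: stabilizer_def stable_def)
  have "subgroup (stabilizer V) G"
  proof (rule subgroupI)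
    show "stabilizer V \<subseteq> carrier G" by (auto simp: stabilizer_def)
    show "stabilizer V \<noteq> {}" using one by blast
    fix a assume a: "a \<in> stabilizer V"
    have ac: "a \<in> carrier G" using a by (simp add: stabilizer_def)
    have "a <# V \<subseteq> V" using a ac in_carrier[OF assms(1)] m_comm[OF ac] by (auto simp: stabilizer_def l_coset_def)
    then have eq: "a <# V = V"
      using flat_eqI[of "a <# V" V] flat_translate d_translate ac assms(1) by simp
    have "inv a \<otimes> x \<in> V" if "x \<in> V" for x
      using that eq mem_l_coset[OF ac flat_subset[OF assms(1)], of x] by simp
    then show "inv a \<in> stabilizer V"
      using ac in_carrier[OF assms(1)] m_comm[of "inv a"] by (simp add: stabilizer_def)
    fix b assume b: "b \<in> stabilizer V"
    have bc: "b \<in> carrier G" using b by (simp add: stabilizer_def)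
    show "a \<otimes> b \<in> stabilizer V"
      using a b ac bc in_carrier[OF assms(1)] by (auto simp: stabilizer_def m_assoc[symmetric])
  qed
  then show "flat_subgroup (stabilizer V)" using f by (simp add: flat_subgroup_def)
qed

text \<open>For \<open>S = mul B H\<close> and \<open>V = mul A H\<close> the image of
  \<open>V\<close> is \<open>mul A B\<close>. The group \<open>N\<close> found at the boundary of
  \<open>sat V\<close> stabilizes \<open>mul A B\<close>, hence lies in \<open>H\<close> and
  stabilizes \<open>S\<close>, which forces \<open>d S = bd (sat V) + d N\<close>. If the inequality
  failed, \<open>S\<close> would be larger.\<close>

theorem kneser:
  assumes A: "A \<in> flats" "A \<noteq> {}" and B: "B \<in> flats" "B \<noteq> {}"
  defines "H \<equiv> stabilizer (mul A B)"
  shows "d (mul A H) + d (mul B H) \<le> d (mul A B) + d H"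
proof (rule ccontr)
  assume contra: "\<not> ?thesis"
  have Ac: "A \<subseteq> carrier G" and Bc: "B \<subseteq> carrier G" using A B flat_subset by simp_all
  have Cf: "mul A B \<in> flats" using Ac Bc by simp
  have Cne: "mul A B \<noteq> {}" using mulI A(2) B(2) by blast
  note H = stabilizer[OF Cf Cne, folded H_def] and Hs = flat_subgroupD[OF stabilizer(1)[OF Cf Cne, folded H_def]]
  define S where "S = mul B H"
  have Sf: "S \<in> flats" using Bc Hs(2) by (simp add: S_def)
  have BS: "b \<in> S" if "b \<in> B" for b using mulI[OF that Hs(3)] that Bc by (auto simp: S_def)
  have stS: "stable H S"
    unfolding S_def using stable_mul[of H B H] mul_commute[of B H] Bc Hs(2,4) by simp
  interpret flat_group_base G flats d S
    by unfold_locales (use Sf BS B(2) in auto)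
  define V where "V = mul A H"
  have Vf: "V \<in> flats" using Ac Hs(2) by (simp add: V_def)
  have AV: "a \<in> V" if "a \<in> A" for a using mulI[OF that Hs(3)] that Ac by (auto simp: V_def)
  have stV: "stable H V"
    unfolding V_def using stable_mul[of H A H] mul_commute[of A H] Ac Hs(2,4) by simp
  have imV: "im V = mul A B"
  proof
    show "mul A B \<subseteq> im V"
      using Vf BS AV imI[OF Vf] m_comm Ac Bc by (subst mul_least) (auto, metis subsetD)
    have 1: "x \<otimes> b \<in> mul A B" if "b \<in> B" "x \<in> V" for x b
    proof -
      have bc: "b \<in> carrier G" using that Bc by blast
      have "V \<subseteq> {x \<in> carrier G. b \<otimes> x \<in> mul A B}"
        unfolding V_def
      proof (subst mul_least[OF flat_quotient1[OF bc Cf]], intro ballI)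
        fix a h assume ah: "a \<in> A" "h \<in> H"
        have "h \<otimes> (a \<otimes> b) \<in> mul A B" using H(2) ah mulI[OF ah(1) that(1)] by (simp add: stable_def)
        moreover have "h \<otimes> (a \<otimes> b) = b \<otimes> (a \<otimes> h)"
          using ah bc Ac Hs(2) by (simp add: subsetD m_ac)
        ultimately show "a \<otimes> h \<in> {x \<in> carrier G. b \<otimes> x \<in> mul A B}"
          using ah Ac Hs(2) by (simp add: subsetD)
      qed
      then show ?thesis using that m_comm[OF bc] in_carrier[OF Vf] by auto
    qed
    have "s \<otimes> x \<in> mul A B" if "s \<in> S" "x \<in> V" for s x
    proof -
      have xc: "x \<in> carrier G" using that in_carrier[OF Vf] by blast
      have "S \<subseteq> {s \<in> carrier G. x \<otimes> s \<in> mul A B}"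
        unfolding S_def
      proof (subst mul_least[OF flat_quotient1[OF xc Cf]], intro ballI)
        fix b h assume bh: "b \<in> B" "h \<in> H"
        have "h \<otimes> (x \<otimes> b) \<in> mul A B" using H(2) bh 1[OF bh(1) that(2)] by (simp add: stable_def)
        moreover have "h \<otimes> (x \<otimes> b) = x \<otimes> (b \<otimes> h)"
          using bh xc Bc Hs(2) by (simp add: subsetD m_ac)
        ultimately show "b \<otimes> h \<in> {s \<in> carrier G. x \<otimes> s \<in> mul A B}"
          using bh Bc Hs(2) by (simp add: subsetD)
      qed
      then show ?thesis using that m_comm[OF xc] in_carrier[OF Sf] by auto
    qed
    then show "im V \<subseteq> mul A B" using Vf Cf by (subst im_least) auto
  qed
  have dv: "d H dvd d V" "d H dvd d S" "d H dvd d (mul A B)"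
    using d_dvd[OF H(1)] stV stS H(2) Vf Sf Cf by simp_all
  \<comment> \<open>All terms are multiples of \<open>d H\<close>, so a failure by one is a failure
    by \<open>d H\<close>.\<close>
  have big: "d (mul A B) + 2 * d H \<le> d V + d S"
  proof -
    have lt: "d (mul A B) + d H < d V + d S" using contra by (simp add: V_def S_def)
    have "d H dvd d V + d S - (d (mul A B) + d H)" using dv by (simp add: dvd_diff_nat)
    then have "d H \<le> d V + d S - (d (mul A B) + d H)" using lt by (intro dvd_imp_le) simp_all
    then show ?thesis using lt by linarith
  qed
  have Vne: "V \<noteq> {}" using A(2) AV by blast
  have cV: "cell (sat V)" using cell_sat[OF Vf Vne] .
  have bdV: "bd (sat V) + 2 * d H \<le> d S"
    using bd_sat_le[OF Vf] big d_im[OF Vf] imV by simp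
  obtain N where N: "cell_group (bd (sat V)) N"
    using exists_cell_group[OF cV refl] bdV Hs(6) by auto
  note Ns = flat_subgroupD[OF cell_groupD(1)[OF N]]
  have "stable N (sat V)" using cell_groupD(4)[OF N cV] by simp
  then have "stable N (mul A B)"
    using stable_im[OF sat_flat[OF Vf] Ns(2)] im_sat[OF Vf] imV by simp
  then have NH: "N \<subseteq> H" using H(3) Ns(2) by simp
  have "im N \<subseteq> S"
  proof -
    have "s \<otimes> x \<in> S" if "x \<in> N" "s \<in> S" for x s
      using that stS NH m_comm[OF in_carrier[OF Sf] in_carrier[OF Ns(1)], of s x]
      by (auto simp: stable_def)
    then show ?thesis using im_least[OF Ns(1) Sf] by blast
  qed
  then have "d (im N) \<le> d S" using d_mono Ns(1) Sf by simp
  then have "d S = bd (sat V) + d N" using cell_group_dims[OF N] by simp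
  moreover have "d N \<le> d H" using d_mono NH Ns(1) Hs(1) by simp
  ultimately show False using bdV Hs(6) by simp
qed

end

section \<open>Flags\<close>

lemma (in flat_group) mul_subgroup:
  assumes "V \<in> flats" "flat_subgroup H"
  shows "mul V H \<in> flats" "stable H (mul V H)" "V \<subseteq> mul V H"
proof -
  note H = flat_subgroupD[OF assms(2)]
  show "mul V H \<in> flats" using assms(1) H(2) by (simp add: flat_subset)
  show "stable H (mul V H)"
    using stable_mul[of H V H] mul_commute[of V H] H(2,4) assms(1) by (simp add: flat_subset)
  show "V \<subseteq> mul V H"
  proof
    fix x assume "x \<in> V"
    then show "x \<in> mul V H" using mulI[OF _ H(3), of x V] in_carrier[OF assms(1)] by simp
  qed
qed

lemma (in flat_group) subgroup_subset_mul:
  assumes "\<one> \<in> V" "flat_subgroup H"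
  shows "H \<subseteq> mul V H"
proof
  fix x assume "x \<in> H"
  then show "x \<in> mul V H" using mulI[OF assms(1), of x H] flat_subgroupD(2)[OF assms(2)] by auto
qed

lemma (in flat_group) d_mul_dvd:
  assumes "V \<in> flats" "flat_subgroup H"
  shows "d H dvd d (mul V H)"
  using d_dvd[OF assms(2)] mul_subgroup[OF assms] by simp

lemma (in flat_group) subgroup_dvd:
  assumes "flat_subgroup H" "flat_subgroup H'" "H \<subseteq> H'"
  shows "d H dvd d H'"
  using d_dvd[OF assms(1) flat_subgroupD(1)[OF assms(2)]] flat_subgroupD(4)[OF assms(2)] assms(3)
  by (auto simp: stable_def)

lemma (in flat_group) subgroup_dvd_n:
  assumes "flat_subgroup H"
  shows "d H dvd n"
  using d_dvd[OF assms flat_carrier] flat_subgroupD(2)[OF assms] by (auto simp: stable_def)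

lemma (in flat_group) flat_subgroup_Int:
  "flat_subgroup H \<Longrightarrow> flat_subgroup H' \<Longrightarrow> flat_subgroup (H \<inter> H')"
  by (auto simp: flat_subgroup_def intro: subgroups_Inter_pair)

text \<open>The dimension of \<open>V\<close> over \<open>H\<close> grows by at most one with each point added to \<open>V\<close>.\<close>

lemma (in flat_group) d_mul_le:
  assumes H: "flat_subgroup H" and VW: "V \<in> flats" "W \<in> flats" "V \<subseteq> W"
  shows "d (mul W H) \<le> d (mul V H) + (d W - d V) * d H"
  using VW
proof (induction "d W - d V" arbitrary: V rule: less_induct)
  case less
  show ?case
  proof (cases "V = W")
    case False
    then obtain u where u: "u \<in> W" "u \<notin> V" using less.prems(3) by blast
    have uc: "u \<in> carrier G" using u in_carrier less.prems(2) by blast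
    let ?V = "join V (clo {u})"
    have V': "?V \<in> flats" "?V \<subseteq> W" "d ?V = d V + 1"
      using less.prems u uc d_join_point[of V u] by (auto simp: join_least hull_least)
    have le: "d V + 1 \<le> d W" using d_mono[OF V'(1) less.prems(2) V'(2)] V'(3) by simp
    note H' = flat_subgroupD[OF H] and mV = mul_subgroup[OF less.prems(1) H] and cu = coset_stable[OF H uc]
    let ?Z = "join (mul V H) (u <# H)"
    have Zf: "?Z \<in> flats" using mV cu by simp
    have stZ: "stable H ?Z" using stable_join[OF mV(1) cu(2) H'(2) mV(2) cu(1)] .
    have "?V \<subseteq> ?Z"
      using Zf mV(3) cu(3) join_upper1[of "mul V H" "u <# H"] join_upper2[of "u <# H" "mul V H"]
      by (simp add: join_least less.prems(1) uc hull_least) blast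
    have "x \<otimes> h \<in> ?Z" if "x \<in> ?V" "h \<in> H" for x h
    proof -
      have "x \<in> carrier G" "h \<in> carrier G" using that V' in_carrier H'(2) by blast+
      moreover have "h \<otimes> x \<in> ?Z" using stZ that \<open>?V \<subseteq> ?Z\<close> by (auto simp: stable_def)
      ultimately show ?thesis by (simp add: m_comm)
    qed
    then have "mul ?V H \<subseteq> ?Z" using Zf by (simp add: mul_least)
    then have "d (mul ?V H) \<le> d ?Z" using d_mono[OF _ Zf] mul_subgroup[OF V'(1) H] by simp
    also have "\<dots> \<le> d (mul V H) + d H" using d_join[OF mV(1) cu(2)] cu(4) by simp
    finally have 1: "d (mul ?V H) \<le> d (mul V H) + d H" .
    have "d (mul W H) \<le> d (mul ?V H) + (d W - d ?V) * d H"
      using less.hyps[OF _ V'(1) less.prems(2) V'(2)] V'(3) le by simp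
    also have "\<dots> \<le> d (mul V H) + (1 + (d W - d ?V)) * d H" using 1 by simp
    also have "1 + (d W - d ?V) = d W - d V" using V'(3) le by simp
    finally show ?thesis .
  qed simp
qed

locale flat_flag = flat_group +
  fixes F :: "nat \<Rightarrow> 'a set" and T :: "nat \<Rightarrow> nat \<Rightarrow> nat"
  assumes F_flat [simp]: "i < d (carrier G) \<Longrightarrow> F i \<in> flats"
    and d_F [simp]: "i < d (carrier G) \<Longrightarrow> d (F i) = i + 1"
    and F_mono: "i \<le> j \<Longrightarrow> j < d (carrier G) \<Longrightarrow> F i \<subseteq> F j"
    and one_F0: "\<one> \<in> F 0"
    and T_less: "i < d (carrier G) \<Longrightarrow> j < d (carrier G) \<Longrightarrow> T i j < d (carrier G)"
    and T_sym: "i < d (carrier G) \<Longrightarrow> j < d (carrier G) \<Longrightarrow> T i j = T j i"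
    and F_T: "i < d (carrier G) \<Longrightarrow> j < d (carrier G) \<Longrightarrow> x \<in> F i \<Longrightarrow> y \<in> F j \<Longrightarrow> x \<otimes> y \<in> F (T i j)"
begin

definition stab :: "nat \<Rightarrow> nat \<Rightarrow> 'a set" where "stab i j = stabilizer (mul (F i) (F j))"

text \<open>\<open>i div h + 1\<close> is the least number of \<open>h\<close>-dimensional pieces
  that can cover dimension \<open>i + 1\<close>. The case \<open>h = 1\<close> reads
  \<open>i + j \<le> T i j\<close>, and \<open>h = n\<close> reads
  \<open>T i j = n - 1\<close>.\<close>

definition good :: "nat \<Rightarrow> nat \<Rightarrow> nat \<Rightarrow> bool" where
  "good h i j \<longleftrightarrow> h * (i div h + j div h + 1) \<le> T i j + 1"

lemma F_sub [simp]: "i < n \<Longrightarrow> F i \<subseteq> carrier G"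
  by (simp add: flat_subset)

lemma one_F [simp]: "i < n \<Longrightarrow> \<one> \<in> F i"
  using F_mono[of 0 i] one_F0 by auto

lemma FF_subset:
  assumes "i < n" "j < n"
  shows "mul (F i) (F j) \<subseteq> F (T i j)" "mul (F i) (F j) \<in> flats" "d (mul (F i) (F j)) \<le> T i j + 1"
proof -
  show 1: "mul (F i) (F j) \<subseteq> F (T i j)" using assms T_less F_T by (simp add: mul_least)
  show 2: "mul (F i) (F j) \<in> flats" using assms by simp
  show "d (mul (F i) (F j)) \<le> T i j + 1" using d_mono[OF 2 _ 1] assms T_less by simp
qed

lemma stab:
  assumes "i < n" "j < n"
  shows "flat_subgroup (stab i j)" "stable (stab i j) (mul (F i) (F j))"
    "d (mul (F i) (stab i j)) + d (mul (F j) (stab i j)) \<le> d (mul (F i) (F j)) + d (stab i j)"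
proof -
  have ne: "F i \<noteq> {}" "F j \<noteq> {}" using one_F assms by blast+
  have ne': "mul (F i) (F j) \<noteq> {}" using mulI[OF one_F[OF assms(1)] one_F[OF assms(2)]] by blast
  show "flat_subgroup (stab i j)" "stable (stab i j) (mul (F i) (F j))"
    unfolding stab_def using stabilizer(1,2) FF_subset(2)[OF assms] ne' by simp_all
  show "d (mul (F i) (stab i j)) + d (mul (F j) (stab i j)) \<le> d (mul (F i) (F j)) + d (stab i j)"
    unfolding stab_def using kneser ne assms by simp
qed

text \<open>\<open>a\<close>, \<open>b\<close>, \<open>c\<close> are dimensions over the stabilizer,
  and \<open>a + b \<le> c + 1\<close> is Kneser's bound divided by \<open>h\<close>.\<close>

lemma stab_numbers:
  assumes "i < n" "j < n" "d (stab i j) = h"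
  obtains a b c where "d (mul (F i) (stab i j)) = h * a" "d (mul (F j) (stab i j)) = h * b"
    "d (mul (F i) (F j)) = h * c" "i + 1 \<le> h * a" "j + 1 \<le> h * b" "a + b \<le> c + 1" "h * c \<le> T i j + 1"
proof -
  note s = stab[OF assms(1,2)]
  have "h dvd d (mul (F i) (stab i j))" "h dvd d (mul (F j) (stab i j))" "h dvd d (mul (F i) (F j))"
    using d_mul_dvd[OF _ s(1)] d_dvd[OF s(1) _ s(2)] FF_subset(2) assms by auto
  then obtain a b c where abc: "d (mul (F i) (stab i j)) = h * a" "d (mul (F j) (stab i j)) = h * b"
    "d (mul (F i) (F j)) = h * c" by (auto elim!: dvdE)
  have "i + 1 \<le> h * a" "j + 1 \<le> h * b"
    using d_mono[OF _ _ mul_subgroup(3)[OF _ s(1)]] mul_subgroup(1)[OF _ s(1)] assms(1,2) abc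
    by (metis F_flat d_F)+
  moreover have "h * a + h * b \<le> h * c + h" using s(3) abc assms(3) by simp
  then have "h * (a + b) \<le> h * (c + 1)" by (simp add: distrib_left)
  then have "a + b \<le> c + 1"
    using flat_subgroupD(6)[OF s(1)] assms(3) mult_le_cancel1[of h "a + b" "c + 1"] by blast
  moreover have "h * c \<le> T i j + 1" using FF_subset(3) assms abc by metis
  ultimately show ?thesis using that abc by blast
qed

lemma good_stab:
  assumes "i < n" "j < n"
  shows "good (d (stab i j)) i j" "d (stab i j) dvd n"
proof -
  obtain h where h: "d (stab i j) = h" by simp
  obtain a b c where abc: "i + 1 \<le> h * a" "j + 1 \<le> h * b" "a + b \<le> c + 1" "h * c \<le> T i j + 1"
    using stab_numbers[OF assms h] by metis
  have "i div h < a" "j div h < b" using abc(1,2) by (simp_all add: less_mult_imp_div_less mult.commute)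
  then have "i div h + j div h + 1 \<le> c" using abc(3) by simp
  then have "h * (i div h + j div h + 1) \<le> h * c" by (rule mult_le_mono2)
  then show "good (d (stab i j)) i j" using abc(4) h by (simp only: good_def)
  show "d (stab i j) dvd n" using subgroup_dvd_n stab(1)[OF assms] .
qed

lemma good_sym: "i < n \<Longrightarrow> j < n \<Longrightarrow> good h i j = good h j i"
  using T_sym[of i j] by (simp add: good_def add.commute)

section \<open>Stabilizers of coprime orders\<close>

lemma mul_coprime:
  assumes "flat_subgroup H" "flat_subgroup H'" "coprime (d H) (d H')" "d H * d H' = n"
  shows "mul H H' = carrier G"
proof -
  note H = flat_subgroupD[OF assms(1)] and H' = flat_subgroupD[OF assms(2)]
  have f: "mul H H' \<in> flats" using H H' by simp
  have "d H dvd d (mul H H')"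
    using d_dvd[OF assms(1) f] stable_mul[OF H(2) H'(2) H(2,4)] .
  moreover have "d H' dvd d (mul H H')" using d_mul_dvd[OF H(1) assms(2)] .
  ultimately have "n dvd d (mul H H')" using assms(3,4) divides_mult by metis
  moreover have "0 < d (mul H H')" using d_le_mul[OF H(1) H'(1)] H(6) H'(3) by force
  ultimately have "n \<le> d (mul H H')" by (rule dvd_imp_le)
  then show ?thesis using flat_eqI[OF f flat_carrier] flat_subset[OF f] by simp
qed

text \<open>If \<open>i' \<le> j\<close>, a translate of \<open>F i' \<inter> H'\<close> by an
  element of \<open>H\<close> stays in \<open>F (T i j)\<close>, hence in
  \<open>F (T i' j')\<close>, and is disjoint from \<open>mul (F i') (F j')\<close>: too much for
  \<open>F (T i' j')\<close>. If \<open>j < i'\<close>, the large parts of \<open>H\<close> in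
  \<open>F i\<close> and \<open>F j\<close> make \<open>mul (F i') H'\<close> and
  \<open>mul (F j') H'\<close> too large.\<close>

lemma coprime_conflict_aux:
  assumes ij: "i \<le> j" "j < n" and ij': "i' \<le> j'" "j' < n"
    and cop: "coprime (d (stab i j)) (d (stab i' j'))" "d (stab i j) * d (stab i' j') = n"
    and small: "T i j < i + j" "T i' j' < i' + j'" "T i' j' + 1 < n"
    and le: "T i j \<le> T i' j'"
  shows False
proof -
  have i: "i < n" "i' < n" using ij ij' by simp_all
  define H where "H = stab i j"
  define H' where "H' = stab i' j'"
  note s = stab[OF i(1) ij(2), folded H_def] and s' = stab[OF i(2) ij'(2), folded H'_def]
  note Hs = flat_subgroupD[OF s(1)] and Hs' = flat_subgroupD[OF s'(1)]
  let ?C' = "mul (F i') (F j')"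
  note FF = FF_subset[OF i(1) ij(2)] and FF' = FF_subset[OF i(2) ij'(2)]
  have HH': "mul H H' = carrier G" using mul_coprime[OF s(1) s'(1)] cop by (simp add: H_def H'_def)
  have n: "d H * d H' = n" using cop(2) by (simp add: H_def H'_def)
  \<comment> \<open>Both \<open>F a\<close> and \<open>K\<close> lie in \<open>mul (F a) K\<close>,
    so a small product forces a large intersection.\<close>
  have meet: "d (F a) + d K \<le> d (F a \<inter> K) + d (mul (F a) K)" if "a < n" "flat_subgroup K" for a K
  proof -
    note Ks = flat_subgroupD[OF that(2)] and mK = mul_subgroup[OF F_flat[OF that(1)] that(2)]
    have "join (F a) K \<subseteq> mul (F a) K"
      using mK subgroup_subset_mul[OF one_F[OF that(1)] that(2)] by (simp add: join_least)
    then have "d (join (F a) K) \<le> d (mul (F a) K)" using that Ks(1) mK(1) by (simp add: d_mono)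
    then show ?thesis using d_join[OF F_flat[OF that(1)] Ks(1)] by simp
  qed
  have loss: "d (mul (F i) H) + d (mul (F j) H) \<le> i + j + d H" using s(3) FF(3) small(1) by linarith
  show False
  proof (cases "i' \<le> j")
    case True
    let ?S = "F i' \<inter> H'"
    have Sf: "?S \<in> flats" using Hs'(1) i by simp
    have "\<not> H \<subseteq> ?C'"
    proof
      assume HC: "H \<subseteq> ?C'"
      have "x \<otimes> y \<in> ?C'" if "x \<in> H" "y \<in> H'" for x y
      proof -
        have "y \<otimes> x \<in> ?C'" using s'(2) that HC by (auto simp: stable_def)
        then show ?thesis using that Hs(2) Hs'(2) by (metis m_comm subsetD)
      qed
      then have "carrier G \<subseteq> ?C'" using HH' mul_least[OF FF'(2)] by metis
      then have "n \<le> d ?C'" using d_mono[OF flat_carrier FF'(2)] by simp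
      then show False using FF'(3) small(3) by simp
    qed
    then obtain t where t: "t \<in> H" "t \<notin> ?C'" by blast
    have tc: "t \<in> carrier G" using t Hs(2) by blast
    have "(t <# H') \<inter> ?C' = {}"
      using coset_Int_stable[OF Hs'(5) s'(2) flat_subset[OF FF'(2)] tc t(2)] .
    then have disj: "(t <# ?S) \<inter> ?C' = {}" using l_coset_mono[of ?S H' t] by blast
    have "t \<otimes> x \<in> F (T i' j')" if "x \<in> ?S" for x
    proof -
      have xc: "x \<in> carrier G" using that i F_sub by blast
      have "x \<in> F j" using that F_mono[OF True ij(2)] by blast
      then have "\<one> \<otimes> x \<in> mul (F i) (F j)" using mulI[OF one_F[OF i(1)]] by blast
      then have "t \<otimes> x \<in> mul (F i) (F j)" using s(2) t(1) xc by (auto simp: stable_def)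
      then show ?thesis using FF(1) F_mono[OF le T_less[OF i(2) ij'(2)]] by blast
    qed
    then have sub: "t <# ?S \<subseteq> F (T i' j')" by (auto simp: l_coset_def)
    have tS: "t <# ?S \<in> flats" "d (t <# ?S) = d ?S" using flat_translate d_translate tc Sf by simp_all
    have "join (t <# ?S) ?C' \<subseteq> F (T i' j')"
      using sub FF'(1) T_less[OF i(2) ij'(2)] by (simp add: join_least)
    then have "d (join (t <# ?S) ?C') \<le> T i' j' + 1"
      using d_mono[of "join (t <# ?S) ?C'" "F (T i' j')"] tS(1) FF'(2) T_less[OF i(2) ij'(2)] by simp
    then have "d ?S + d ?C' \<le> T i' j' + 1" using d_join[OF tS(1) FF'(2)] disj tS(2) by simp
    moreover have "j' + 1 \<le> d (mul (F j') H')"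
      using d_mono[OF _ _ mul_subgroup(3)[OF _ s'(1)], of "F j'"] mul_subgroup(1)[OF _ s'(1)] ij'(2) by simp
    ultimately show False using meet[OF i(2) s'(1)] s'(3) small(2) i(2) d_F[OF i(2)] by linarith
  next
    case False
    \<comment> \<open>\<open>mul H H'\<close> has dimension \<open>d H * d H'\<close>, so
      \<open>H\<close> is independent over \<open>H'\<close>: each dimension of
      \<open>F a \<inter> H\<close> accounts for \<open>d H'\<close> dimensions of the
      product.\<close>
    have lower: "(a + 1 + d H - d (mul (F a) H)) * d H' \<le> d (mul (F b) H')" if ab: "a \<le> b" "b < n" for a b
    proof -
      let ?R = "F a \<inter> H"
      have Rf: "?R \<in> flats" using Hs(1) ab by simp
      have dR: "d ?R \<le> d H" using d_mono[OF Rf Hs(1)] by simp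
      have "d (mul H H') \<le> d (mul ?R H') + (d H - d ?R) * d H'"
        using d_mul_le[OF s'(1) Rf Hs(1)] by simp
      then have "d H * d H' \<le> d (mul ?R H') + (d H - d ?R) * d H'" using HH' n by simp
      moreover obtain r where "d H = d ?R + r" using dR le_Suc_ex by blast
      ultimately have "d ?R * d H' \<le> d (mul ?R H')" by (simp add: add_mult_distrib)
      also have "\<dots> \<le> d (mul (F b) H')"
        using F_mono[OF ab] ab Hs'(1,2) Rf mul_mono[of "F b" H' ?R H'] mul_subgroup(1)[OF _ s'(1)]
        by (intro d_mono) auto
      finally have "d ?R * d H' \<le> d (mul (F b) H')" .
      moreover have "a + 1 + d H - d (mul (F a) H) \<le> d ?R" using meet[of a H] ab s(1) by simp
      ultimately show ?thesis by (meson mult_le_mono1 order_trans)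
    qed
    \<comment> \<open>Ensures that the subtractions in \<open>lower\<close> are not
      truncated.\<close>
    have "d (mul (F i) H) \<le> i + 1 + d H" "d (mul (F j) H) \<le> j + 1 + d H"
      using meet[OF i(1) s(1)] meet[OF ij(2) s(1)] loss
        d_mono[OF _ _ mul_subgroup(3)[OF _ s(1)], of "F i"] d_mono[OF _ _ mul_subgroup(3)[OF _ s(1)], of "F j"]
        mul_subgroup(1)[OF _ s(1)] i ij by auto
    then have "d H + 2 \<le> (i + 1 + d H - d (mul (F i) H)) + (j + 1 + d H - d (mul (F j) H))"
      using loss by linarith
    then have "(d H + 2) * d H' \<le> (i + 1 + d H - d (mul (F i) H)) * d H' + (j + 1 + d H - d (mul (F j) H)) * d H'"
      by (metis add_mult_distrib mult_le_mono1)
    also have "\<dots> \<le> d (mul (F i') H') + d (mul (F j') H')"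
      using lower[of i i'] lower[of j j'] False ij ij' i by simp
    also have "\<dots> \<le> n + d H'" using s'(3) FF'(3) small(3) by linarith
    finally have "d H * d H' + 2 * d H' \<le> n + d H'" by (simp add: add_mult_distrib)
    then show False using n Hs'(6) by simp
  qed
qed

lemma coprime_conflict:
  assumes ij: "i \<le> j" "j < n" and ij': "i' \<le> j'" "j' < n"
    and cop: "coprime (d (stab i j)) (d (stab i' j'))" "d (stab i j) * d (stab i' j') = n"
    and bad: "\<not> good 1 i j" "\<not> good n i j" "\<not> good 1 i' j'" "\<not> good n i' j'"
  shows False
proof -
  have small: "T i j < i + j" "T i' j' < i' + j'" "T i j + 1 < n" "T i' j' + 1 < n"
    using bad ij ij' by (simp_all add: good_def)
  show False
  proof (cases "T i j \<le> T i' j'")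
    case True
    then show ?thesis using coprime_conflict_aux[OF ij ij' cop] small by simp
  next
    case False
    then show ?thesis
      using coprime_conflict_aux[OF ij' ij] cop small by (simp add: coprime_commute mult.commute)
  qed
qed

section \<open>Prime powers and products of two primes\<close>

definition tower_good :: "nat list \<Rightarrow> bool" where
  "tower_good ps \<longleftrightarrow> (\<forall>i<n. \<forall>j<n. \<exists>s\<le>length ps. good (prod_list (take s ps)) i j)"

lemma not_tower_good:
  assumes "\<not> tower_good ps"
  obtains i j where "i \<le> j" "j < n" "\<And>s. s \<le> length ps \<Longrightarrow> \<not> good (prod_list (take s ps)) i j"
proof -
  obtain i j where ij: "i < n" "j < n" "\<And>s. s \<le> length ps \<Longrightarrow> \<not> good (prod_list (take s ps)) i j"
    using assms by (auto simp: tower_good_def)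
  show ?thesis
  proof (cases "i \<le> j")
    case True
    then show ?thesis using that ij by blast
  next
    case False
    then show ?thesis using that[of j i] ij good_sym by simp
  qed
qed

lemma tower_good_prime_power:
  assumes "Factorial_Ring.prime p" "n = p ^ k"
  shows "tower_good (replicate k p)"
  unfolding tower_good_def
proof (intro allI impI)
  fix i j assume ij: "i < n" "j < n"
  obtain m where "m \<le> k" "d (stab i j) = p ^ m"
    using good_stab(2)[OF ij] assms divides_primepow_nat by metis
  then have "good (prod_list (take m (replicate k p))) i j"
    using good_stab(1)[OF ij] by (simp add: min_def)
  then show "\<exists>s\<le>length (replicate k p). good (prod_list (take s (replicate k p))) i j"
    using \<open>m \<le> k\<close> by auto
qed

text \<open>\<open>[p, q]\<close> can fail only at a stabilizer of order \<open>q\<close>, and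
  \<open>[q, p]\<close> only at one of order \<open>p\<close>.\<close>

lemma tower_good_two_primes:
  assumes p: "Factorial_Ring.prime p" and q: "Factorial_Ring.prime q" and "p \<noteq> q" "n = p * q"
  shows "tower_good [p, q] \<or> tower_good [q, p]"
proof (rule ccontr)
  assume neg: "\<not> ?thesis"
  have two: "h = 1 \<or> h = a \<or> h = b \<or> h = n"
    if "Factorial_Ring.prime a" "Factorial_Ring.prime b" "n = a * b" "h dvd n" for a b h
  proof -
    have "\<exists>x y. h = x * y \<and> x dvd a \<and> y dvd b" using division_decomp[of h a b] that(3,4) by simp
    then obtain x y where "h = x * y" "x dvd a" "y dvd b" by blast
    moreover from this have "x = 1 \<or> x = a" "y = 1 \<or> y = b"
      using that(1,2) by (meson prime_nat_iff)+
    ultimately show ?thesis using that(3) by auto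
  qed
  have main: "\<exists>i j. i \<le> j \<and> j < n \<and> \<not> good 1 i j \<and> \<not> good n i j \<and> d (stab i j) = b"
    if ab: "\<not> tower_good [a, b]" "Factorial_Ring.prime a" "Factorial_Ring.prime b" "n = a * b" for a b
  proof -
    obtain i j where ij: "i \<le> j" "j < n" "\<And>s. s \<le> length [a, b] \<Longrightarrow> \<not> good (prod_list (take s [a, b])) i j"
      using not_tower_good[OF ab(1)] by metis
    have g: "\<not> good 1 i j" "\<not> good a i j" "\<not> good n i j"
      using ij(3)[of 0] ij(3)[of 1] ij(3)[of 2] ab(4) by simp_all
    have "d (stab i j) = b"
      using two[OF ab(2-4)] good_stab[of i j] g ij(1,2) by force
    then show ?thesis using g ij by blast
  qed
  obtain i j where ij: "i \<le> j" "j < n" "\<not> good 1 i j" "\<not> good n i j" "d (stab i j) = q"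
    using main[of p q] neg p q assms(4) by blast
  obtain i' j' where ij': "i' \<le> j'" "j' < n" "\<not> good 1 i' j'" "\<not> good n i' j'" "d (stab i' j') = p"
    using main[of q p] neg p q assms(4) by (auto simp: mult.commute)
  have "coprime q p" using p q assms(3) primes_coprime by metis
  then show False
    using coprime_conflict[OF ij(1,2) ij'(1,2)] ij ij' assms(4) by (simp add: mult.commute)
qed

end

section \<open>Degree 12\<close>

lemma dvd_12:
  assumes "h dvd (12::nat)"
  shows "h = 1 \<or> h = 2 \<or> h = 3 \<or> h = 4 \<or> h = 6 \<or> h = 12"
proof -
  have "h \<le> 12" using assms by (simp add: dvd_imp_le)
  moreover have "h \<noteq> 0 \<and> h \<noteq> 5 \<and> h \<noteq> 7 \<and> h \<noteq> 8 \<and> h \<noteq> 9 \<and> h \<noteq> 10 \<and> h \<noteq> 11" using assms by (intro conjI notI) simp_all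
  ultimately show ?thesis by presburger
qed

lemma (in flat_group) subgroup_subset_stable:
  assumes "flat_subgroup H" "stable H V" "\<one> \<in> V"
  shows "H \<subseteq> V"
proof
  fix h assume "h \<in> H"
  then have "h \<otimes> \<one> \<in> V" "h \<in> carrier G"
    using assms flat_subgroupD(2)[OF assms(1)] by (auto simp: stable_def)
  then show "h \<in> V" by simp
qed

context flat_flag
begin

lemma F_subset_subgroup:
  assumes "b < n" "flat_subgroup K" "d (mul (F b) K) = d K"
  shows "F b \<subseteq> K"
proof -
  note m = mul_subgroup[OF F_flat[OF assms(1)] assms(2)]
  have "K = mul (F b) K"
    using flat_eqI[OF flat_subgroupD(1)[OF assms(2)] m(1)] subgroup_subset_mul[OF one_F assms(2)] assms(1,3)
    by simp
  then show ?thesis using m(3) by simp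
qed

text \<open>The failures confine the indices so far that both stabilizers contain
  \<open>F 2\<close>, of dimension 3, while the dimension of their intersection divides 2.\<close>

lemma conflict_4_6:
  assumes n: "n = 12" and ij: "i \<le> j" "j < n" and ij': "i' \<le> j'" "j' < n"
    and st: "d (stab i j) = 4" "d (stab i' j') = 6"
    and bad: "\<not> good 1 i j" "\<not> good 2 i j" "\<not> good n i j"
    and bad': "\<not> good 1 i' j'" "\<not> good 2 i' j'" "\<not> good n i' j'"
  shows False
proof -
  have i: "i < n" "i' < n" using ij ij' by simp_all
  note s = stab(1)[OF i(1) ij(2)] and s' = stab(1)[OF i(2) ij'(2)]
  have F2: "F 2 \<subseteq> stab i j"
  proof -
    obtain a b c where abc: "d (mul (F i) (stab i j)) = 4 * a" "d (mul (F j) (stab i j)) = 4 * b"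
      "i + 1 \<le> 4 * a" "j + 1 \<le> 4 * b" "a + b \<le> c + 1" "4 * c \<le> T i j + 1"
      using stab_numbers[OF i(1) ij(2) st(1)] by metis
    have t: "T i j < i + j" "T i j + 1 < 12" using bad(1,3) n i ij by (simp_all add: good_def)
    have "0 < a" "0 < b" "c \<le> 2" using abc t by linarith+
    then have "(a = 1 \<and> b = 1) \<or> (a = 1 \<and> b = 2) \<or> (a = 2 \<and> b = 1)" using abc(5) by linarith
    moreover have "\<not> (a = 2 \<and> b = 1)" using abc t ij by linarith
    moreover have "2 \<le> j" if "a = 1" "b = 1" using that abc t ij by linarith
    \<comment> \<open>The only other possibility, indices 1 and 7 with value 7, satisfies the bound
      for \<open>h = 2\<close>.\<close>
    moreover have "2 \<le> i" if "a = 1" "b = 2"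
    proof (rule ccontr)
      assume "\<not> ?thesis"
      then have "i = 1" "j = 7" "T i j = 7" using that abc t by linarith+
      then show False using bad(2) by (simp add: good_def)
    qed
    ultimately have "(a = 1 \<and> 2 \<le> i) \<or> (b = 1 \<and> 2 \<le> j)" by auto
    then show ?thesis
      using F_subset_subgroup[OF i(1) s] F_subset_subgroup[OF ij(2) s] abc(1,2) st(1)
        F_mono[of 2 i] F_mono[of 2 j] i ij by auto
  qed
  have "F 4 \<subseteq> stab i' j'"
  proof -
    obtain a b c where abc: "d (mul (F j') (stab i' j')) = 6 * b"
      "i' + 1 \<le> 6 * a" "j' + 1 \<le> 6 * b" "a + b \<le> c + 1" "6 * c \<le> T i' j' + 1"
      using stab_numbers[OF i(2) ij'(2) st(2)] by metis
    have t: "T i' j' < i' + j'" "T i' j' + 1 < 12" using bad'(1,3) n i ij' by (simp_all add: good_def)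
    have "0 < a" "0 < b" "c \<le> 1" using abc t by linarith+
    then have b: "b = 1" "c = 1" using abc(4) by linarith+
    \<comment> \<open>The only other possibility, indices 3 and 3 with value 5, satisfies the bound
      for \<open>h = 2\<close>.\<close>
    have "4 \<le> j'"
    proof (rule ccontr)
      assume "\<not> ?thesis"
      then have "i' = 3" "j' = 3" "T i' j' = 5" using b abc t ij' by linarith+
      then show False using bad'(2) by (simp add: good_def)
    qed
    then show ?thesis
      using F_subset_subgroup[OF ij'(2) s'] abc(1) b st(2) F_mono[of 4 j'] ij' by auto
  qed
  then have "F 2 \<subseteq> stab i j \<inter> stab i' j'" using F2 F_mono[of 2 4] n by auto
  moreover have I: "flat_subgroup (stab i j \<inter> stab i' j')" using flat_subgroup_Int[OF s s'] .
  ultimately have "d (F 2) \<le> d (stab i j \<inter> stab i' j')"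
    using d_mono[OF F_flat[of 2] flat_subgroupD(1)[OF I]] n by simp
  moreover have "d (stab i j \<inter> stab i' j') dvd 4" "d (stab i j \<inter> stab i' j') dvd 6"
    using subgroup_dvd[OF I s] subgroup_dvd[OF I s'] st by auto
  then have "d (stab i j \<inter> stab i' j') dvd gcd 4 6" by (rule gcd_greatest)
  then have "d (stab i j \<inter> stab i' j') \<le> 2"
    by (simp add: gcd_non_0_nat dvd_imp_le)
  ultimately show False using n by simp
qed

text \<open>Products with \<open>F 1\<close>, \<open>F 2\<close>, \<open>F 3\<close> and
  \<open>F 7\<close> decide: a flat stable under both stabilizers has dimension divisible by 6, and
  in each remaining case one is found with 4 or fewer, or with 8 or 9, dimensions.\<close>

lemma conflict_2_3:
  assumes n: "n = 12" and ij: "i \<le> j" "j < n" and ij': "i' \<le> j'" "j' < n"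
    and st: "d (stab i j) = 2" "d (stab i' j') = 3"
    and bad: "\<not> good 1 i j" "\<not> good 6 i j" "\<not> good n i j"
    and bad': "\<not> good 1 i' j'" "\<not> good 6 i' j'" "\<not> good n i' j'"
  shows False
proof -
  have i: "i < n" "i' < n" using ij ij' by simp_all
  let ?H = "stab i j" and ?H' = "stab i' j'"
  note s = stab(1)[OF i(1) ij(2)] and s' = stab(1)[OF i(2) ij'(2)]
  note H = flat_subgroupD[OF s] and H' = flat_subgroupD[OF s']
  have six: "6 dvd d V" if "V \<in> flats" "stable ?H V" "stable ?H' V" for V
  proof -
    have "2 dvd d V" "3 dvd d V" using d_dvd[OF s that(1,2)] d_dvd[OF s' that(1,3)] st by simp_all
    then show ?thesis by presburger
  qed
  obtain a b c where abc: "d (mul (F i) ?H) = 2 * a" "d (mul (F j) ?H) = 2 * b"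
    "i + 1 \<le> 2 * a" "j + 1 \<le> 2 * b" "a + b \<le> c + 1" "2 * c \<le> T i j + 1"
    using stab_numbers[OF i(1) ij(2) st(1)] by metis
  have t: "T i j < i + j" "T i j + 1 < 12" using bad(1,3) n i ij by (simp_all add: good_def)
  \<comment> \<open>The chain \<open>2 * c \<le> T i j + 1 \<le> i + j \<le> 2 * (a + b - 1) \<le> 2
    * c\<close> collapses, so \<open>F i\<close> and \<open>F j\<close> are themselves stable under
    \<open>?H\<close>.\<close>
  have eq: "i + 1 = 2 * a" "j + 1 = 2 * b" "T i j + 1 = i + j" using abc t by linarith+
  have stF: "stable ?H (F x)" if "x = i \<or> x = j" for x
  proof -
    have x: "x < n" "d (mul (F x) ?H) = x + 1" using that i ij abc eq by auto
    note m = mul_subgroup[OF F_flat[OF x(1)] s]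
    have "F x = mul (F x) ?H" using flat_eqI[OF F_flat[OF x(1)] m(1,3)] x by simp
    then show ?thesis using m(2) by simp
  qed
  have HF: "?H \<subseteq> F x" if "x = i \<or> x = j" for x
    using subgroup_subset_stable[OF s stF[OF that]] that i ij by auto
  obtain a' b' c' where abc': "d (mul (F i') ?H') = 3 * a'" "d (mul (F j') ?H') = 3 * b'"
    "i' + 1 \<le> 3 * a'" "j' + 1 \<le> 3 * b'" "a' + b' \<le> c' + 1" "3 * c' \<le> T i' j' + 1"
    using stab_numbers[OF i(2) ij'(2) st(2)] by metis
  have t': "T i' j' < i' + j'" "T i' j' + 1 < 12" using bad'(1,3) n i ij' by (simp_all add: good_def)
  have "\<not> (j' \<le> 5 \<and> 5 \<le> T i' j')" using bad'(2) ij' by (auto simp: good_def)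
  moreover have "0 < a'" "0 < b'" "c' \<le> 3" using abc' t' by linarith+
  then have "(a' = 1 \<and> b' = 1) \<or> (a' = 1 \<and> b' = 2) \<or> (a' = 1 \<and> b' = 3) \<or> (a' = 2 \<and> b' = 1)
      \<or> (a' = 2 \<and> b' = 2) \<or> (a' = 3 \<and> b' = 1)" using abc'(5) by linarith
  ultimately have "a' = 1 \<and> 1 \<le> i' \<and> (b' = 1 \<and> 2 \<le> j' \<or> b' = 3 \<and> 7 \<le> j')"
    using abc'(3-6) t' ij' by (elim disjE conjE; simp; linarith)
  then have ab': "a' = 1" "1 \<le> i'" "b' = 1 \<and> 2 \<le> j' \<or> b' = 3 \<and> 7 \<le> j'" by simp_all
  have "F 1 \<subseteq> ?H'"
    using F_subset_subgroup[OF i(2) s'] abc'(1) ab'(1,2) st(2) F_mono[of 1 i'] i by auto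
  have "i \<noteq> 1"
  proof
    assume "i = 1"
    then have "?H \<subseteq> ?H'" using HF[of i] \<open>F 1 \<subseteq> ?H'\<close> by auto
    then have "(2::nat) dvd 3" using subgroup_dvd[OF s s'] st by simp
    then show False by simp
  qed
  have "0 < a" "a + b \<le> 6" "a \<le> b" using eq t ij by linarith+
  then have "(a = 1) \<or> (a = 2 \<and> b = 2) \<or> (a = 2 \<and> b = 3) \<or> (a = 2 \<and> b = 4) \<or> (a = 3 \<and> b = 3)"
    by linarith
  moreover have "\<not> (j \<le> 5 \<and> 5 \<le> T i j)" using bad(2) ij by (auto simp: good_def)
  \<comment> \<open>The bound for \<open>h = 6\<close> would hold for each other pair with
    \<open>i \<noteq> 1\<close>.\<close>
  ultimately have "i = 3" "j = 7" using eq \<open>i \<noteq> 1\<close> by auto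
  from ab'(3) show False
  proof (elim disjE conjE)
    assume "b' = 1" "2 \<le> j'"
    then have "F 2 \<subseteq> ?H'"
      using F_subset_subgroup[OF ij'(2) s'] abc'(2) st(2) F_mono[of 2 j'] ij' by auto
    then have "F 2 = ?H'" using flat_eqI[of "F 2" ?H'] H'(1) st(2) n by simp
    then have "?H' \<subseteq> F 3" using F_mono[of 2 3] n by simp
    then have "mul ?H ?H' \<subseteq> F 3"
      using stF[of 3] \<open>i = 3\<close> n by (auto simp: mul_least stable_def)
    then have le: "d (mul ?H ?H') \<le> 4" using d_mono[of "mul ?H ?H'" "F 3"] H(2) H'(2) n by simp
    have "6 dvd d (mul ?H ?H')"
      using six[of "mul ?H ?H'"] stable_mul[OF H(2) H'(2) H(2,4)] mul_subgroup(1,2)[OF H(1) s'] by simp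
    moreover have "0 < d (mul ?H ?H')" using d_le_mul[OF H(1) H'(1)] H(6) H'(3) by force
    ultimately show False using le dvd_imp_le by fastforce
  next
    assume b: "b' = 3" "7 \<le> j'"
    have f7: "F 7 \<in> flats" using n by simp
    note m = mul_subgroup[OF f7 s']
    have "6 dvd d (mul (F 7) ?H')"
      using six[OF m(1) _ m(2)] stable_mul[OF flat_subset[OF f7] H'(2) H(2) stF[of 7]] \<open>j = 7\<close> by simp
    moreover have "8 \<le> d (mul (F 7) ?H')" using d_mono[OF f7 m(1,3)] n by simp
    moreover have "d (mul (F 7) ?H') \<le> d (mul (F j') ?H')"
      using mul_mono[of "F j'" ?H' "F 7" ?H'] F_mono[OF b(2)] ij'(2) H'(2) m(1)
        mul_subgroup(1)[OF F_flat[OF ij'(2)] s'] by (intro d_mono) auto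
    then have "d (mul (F 7) ?H') \<le> 9" using abc'(2) b by simp
    moreover have "\<not> (6 dvd x \<and> 8 \<le> x \<and> x \<le> 9)" for x :: nat by presburger
    ultimately show False by blast
  qed
qed

text \<open>The three towers can fail only at stabilizers of order 3 or 6, of order 3 or 4, and of
  order 2 or 4, respectively. Every choice contains one of the excluded pairs (3,4), (4,6),
  (2,3).\<close>

lemma tower_good_12:
  assumes n: "n = 12"
  shows "tower_good [2, 2, 3] \<or> tower_good [2, 3, 2] \<or> tower_good [3, 2, 2]"
proof (rule ccontr)
  assume neg: "\<not> ?thesis"
  have bad: "\<exists>i j. i \<le> j \<and> j < n \<and> \<not> good 1 i j \<and> \<not> good p i j \<and> \<not> good (p * q) i j \<and> \<not> good n i j"
    if ng: "\<not> tower_good [p, q, r]" "p * q * r = 12" for p q r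
  proof -
    obtain i j where ij: "i \<le> j" "j < n" "\<And>s. s \<le> length [p, q, r] \<Longrightarrow> \<not> good (prod_list (take s [p, q, r])) i j"
      using not_tower_good[OF ng(1)] by metis
    have "\<not> good 1 i j" "\<not> good p i j" "\<not> good (p * q) i j" "\<not> good n i j"
      using ij(3)[of 0] ij(3)[of 1] ij(3)[of 2] ij(3)[of 3] ng(2) n
      by (simp_all add: eval_nat_numeral mult.assoc)
    then show ?thesis using ij by blast
  qed
  have st: "d (stab i j) \<in> {1, 2, 3, 4, 6, n} \<and> good (d (stab i j)) i j" if "i \<le> j" "j < n" for i j
    using good_stab[of i j] that dvd_12[of "d (stab i j)"] n by auto
  obtain i1 j1 where 1: "i1 \<le> j1" "j1 < n" "\<not> good 1 i1 j1" "\<not> good 2 i1 j1" "\<not> good 4 i1 j1" "\<not> good n i1 j1"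
    using bad[of 2 2 3] neg by auto
  obtain i2 j2 where 2: "i2 \<le> j2" "j2 < n" "\<not> good 1 i2 j2" "\<not> good 2 i2 j2" "\<not> good 6 i2 j2" "\<not> good n i2 j2"
    using bad[of 2 3 2] neg by auto
  obtain i3 j3 where 3: "i3 \<le> j3" "j3 < n" "\<not> good 1 i3 j3" "\<not> good 3 i3 j3" "\<not> good 6 i3 j3" "\<not> good n i3 j3"
    using bad[of 3 2 2] neg by auto
  have s1: "d (stab i1 j1) = 3 \<or> d (stab i1 j1) = 6" using st[OF 1(1,2)] 1 by auto
  have s2: "d (stab i2 j2) = 3 \<or> d (stab i2 j2) = 4" using st[OF 2(1,2)] 2 by auto
  have s3: "d (stab i3 j3) = 2 \<or> d (stab i3 j3) = 4" using st[OF 3(1,2)] 3 by auto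
  have cop: "coprime (3::nat) 4" by (simp add: coprime_iff_gcd_eq_1 gcd_non_0_nat)
  show False
  proof (cases "d (stab i2 j2) = 4")
    case True
    have "d (stab i1 j1) = 6"
      using s1 coprime_conflict[OF 1(1,2) 2(1,2)] True cop n 1 2 by auto
    then show False using conflict_4_6[OF n 2(1,2) 1(1,2) True] 1 2 by blast
  next
    case False
    then have t: "d (stab i2 j2) = 3" using s2 by simp
    have "d (stab i3 j3) = 2"
      using s3 coprime_conflict[OF 2(1,2) 3(1,2)] t cop n 2 3 by auto
    then show False using conflict_2_3[OF n 3(1,2) 2(1,2) _ t] 2 3 by blast
  qed
qed

end

section \<open>Tower types\<close>

text \<open>Digitwise addition without carry, that is, the group law of the tower group on indices.\<close>

fun tower_add :: "nat list \<Rightarrow> nat \<Rightarrow> nat \<Rightarrow> nat" where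
  "tower_add [] a b = 0"
| "tower_add (p # ps) a b = (a + b) mod p + p * tower_add ps (a div p) (b div p)"

lemma tower_digit_Cons:
  "tower_digit (p # ps) m 0 = m mod p"
  "tower_digit (p # ps) m (Suc s) = tower_digit ps (m div p) s"
  by (simp_all add: tower_digit_def div_mult2_eq)

lemma tower_digit_add:
  assumes "\<forall>p\<in>set ps. 0 < p" "s < length ps"
  shows "tower_digit ps (tower_add ps a b) s = (tower_digit ps a s + tower_digit ps b s) mod (ps ! s)"
  using assms
proof (induction ps arbitrary: a b s)
  case (Cons p ps)
  then show ?case
    by (cases s) (simp_all add: tower_digit_Cons mod_add_eq)
qed simp

text \<open>Dropping carries never increases a sum, and dividing by a partial product deletes the
  lowest digits, which digitwise addition respects.\<close>

lemma tower_add_div_le: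
  assumes "\<forall>p\<in>set ps. 0 < p"
  shows "tower_add ps a b div prod_list (take s ps) \<le> a div prod_list (take s ps) + b div prod_list (take s ps)"
  using assms
proof (induction ps arbitrary: a b s)
  case (Cons p ps)
  then have IH: "tower_add ps (a div p) (b div p) div prod_list (take r ps)
      \<le> a div p div prod_list (take r ps) + b div p div prod_list (take r ps)" for r by simp
  show ?case
  proof (cases s)
    case 0
    have "(a + b) mod p \<le> a mod p + b mod p" by (metis mod_add_eq mod_less_eq_dividend)
    moreover have "p * tower_add ps (a div p) (b div p) \<le> p * (a div p + b div p)"
      using IH[of 0] by (intro mult_le_mono2) simp
    ultimately have "tower_add (p # ps) a b \<le> a + b"
      using mod_mult_div_eq[of a p] mod_mult_div_eq[of b p] unfolding tower_add.simps distrib_left by linarith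
    then show ?thesis using 0 by simp
  next
    case (Suc r)
    then show ?thesis using IH[of r] Cons.prems by (simp add: div_mult2_eq)
  qed
qed simp

lemma tower_elt_mult:
  assumes ps: "\<forall>p\<in>set ps. Factorial_Ring.prime p"
  shows "tower_elt ps a \<otimes>\<^bsub>tower_group ps\<^esub> tower_elt ps b = tower_elt ps (tower_add ps a b)"
proof -
  have pos: "\<forall>p\<in>set ps. 0 < p" using ps by (simp add: prime_gt_0_nat)
  show ?thesis
    unfolding tower_elt_eq[OF ps]
    by (auto simp: tower_group_def fun_eq_iff tower_digit_add[OF pos] of_nat_mod)
qed

lemma tower_flag_type_le:
  assumes ps: "prime_tower_type n ps" and t: "t < n"
    and bound: "prod_list (take s ps) * (i div prod_list (take s ps) + j div prod_list (take s ps) + 1) \<le> t + 1"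
  shows "tower_flag_type ps i j \<le> t"
proof -
  let ?P = "prod_list (take s ps)"
  have prime: "\<forall>p\<in>set ps. Factorial_Ring.prime p" and n: "prod_list ps = n"
    using ps by (auto simp: prime_tower_type_def)
  have pos: "\<forall>p\<in>set ps. 0 < p" using prime by (simp add: prime_gt_0_nat)
  have P: "0 < ?P" 
    using pos by (metis gr0I in_set_takeD less_irrefl prod_list_zero_iff)
  have "tower_add ps a b \<le> t" if "a \<le> i" "b \<le> j" for a b
  proof -
    have "tower_add ps a b div ?P \<le> a div ?P + b div ?P" using tower_add_div_le[OF pos] .
    also have "\<dots> < i div ?P + j div ?P + 1" using that by (simp add: add_mono div_le_mono le_imp_less_Suc)
    finally have "tower_add ps a b < (i div ?P + j div ?P + 1) * ?P" using P by (simp add: div_less_iff_less_mult)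
    then show ?thesis using bound by (simp add: mult.commute)
  qed
  then have "tower_flag ps i <#>\<^bsub>tower_group ps\<^esub> tower_flag ps j \<subseteq> tower_flag ps t"
    by (auto simp: set_mult_def tower_flag_def tower_elt_mult[OF prime])
  then show ?thesis
    unfolding tower_flag_type_def group_flag_type_def n using t by (intro Least_le) simp
qed

lemma (in flat_flag) exists_tower:
  assumes "(\<exists>p k. Factorial_Ring.prime p \<and> n = p ^ k) \<or>
    (\<exists>p q. Factorial_Ring.prime p \<and> Factorial_Ring.prime q \<and> p \<noteq> q \<and> n = p * q) \<or> n = 12"
  shows "\<exists>ps. prime_tower_type n ps \<and> flag_type_le n (tower_flag_type ps) T"
proof -
  have le: "flag_type_le n (tower_flag_type ps) T" if ps: "prime_tower_type n ps" "tower_good ps" for ps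
    unfolding flag_type_le_def
  proof (intro allI impI)
    fix i j assume ij: "i < n" "j < n"
    then obtain s where "good (prod_list (take s ps)) i j" using ps(2) by (auto simp: tower_good_def)
    then show "tower_flag_type ps i j \<le> T i j"
      using tower_flag_type_le[OF ps(1) T_less[OF ij]] by (simp only: good_def)
  qed
  have "\<exists>ps. prime_tower_type n ps \<and> tower_good ps"
    using assms
  proof (elim disjE exE conjE)
    fix p k assume p: "Factorial_Ring.prime p" "n = p ^ k"
    then have "prime_tower_type n (replicate k p)" by (simp add: prime_tower_type_def)
    then show ?thesis using tower_good_prime_power[OF p] by blast
  next
    fix p q assume pq: "Factorial_Ring.prime p" "Factorial_Ring.prime q" "p \<noteq> q" "n = p * q"
    then have "prime_tower_type n [p, q]" "prime_tower_type n [q, p]"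
      by (simp_all add: prime_tower_type_def)
    then show ?thesis using tower_good_two_primes[OF pq] by blast
  next
    assume n: "n = 12"
    have "Factorial_Ring.prime (2::nat)" "Factorial_Ring.prime (3::nat)" by simp_all
    then have "prime_tower_type n [2, 2, 3]" "prime_tower_type n [2, 3, 2]" "prime_tower_type n [3, 2, 2]"
      using n by (simp_all add: prime_tower_type_def)
    then show ?thesis using tower_good_12[OF n] by blast
  qed
  then show ?thesis using le by blast
qed

section \<open>Groups and field extensions\<close>

lemma chain_mono:
  fixes F :: "nat \<Rightarrow> 'a set"
  assumes "\<And>i. i + 1 < n \<Longrightarrow> F i \<subseteq> F (i + 1)" "i \<le> j" "j < n"
  shows "F i \<subseteq> F j"
  using assms(2,3)
proof (induction j rule: dec_induct)
  case (step m)
  then show ?case using assms(1)[of m] by auto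
qed simp

lemma flat_hull_Pow: "A \<subseteq> V \<Longrightarrow> flat_hull (Pow V) A = A"
  by (auto simp: flat_hull_def)

lemma flat_group_Pow:
  assumes "comm_group G" "finite (carrier G)"
  shows "flat_group G (Pow (carrier G)) card"
proof -
  interpret comm_group G by fact
  show ?thesis
  proof
    fix u V assume u: "u \<in> carrier G" and V: "V \<in> Pow (carrier G)"
    show "u <#\<^bsub>G\<^esub> V \<in> Pow (carrier G)" using u V by (auto simp: l_coset_def)
    have "u <#\<^bsub>G\<^esub> V = (\<lambda>x. u \<otimes>\<^bsub>G\<^esub> x) ` V" by (auto simp: l_coset_def)
    moreover have "inj_on (\<lambda>x. u \<otimes>\<^bsub>G\<^esub> x) V" using u V by (intro inj_onI) (auto simp: subset_iff)
    ultimately show "card (u <#\<^bsub>G\<^esub> V) = card V" by (simp add: card_image)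
  next
    fix V W assume "V \<in> Pow (carrier G)" "W \<in> Pow (carrier G)"
    then have "finite V" "finite W" "V \<union> W \<subseteq> carrier G" using assms(2) finite_subset by auto
    then show "card (flat_hull (Pow (carrier G)) (V \<union> W)) + card (V \<inter> W) = card V + card W"
      using card_Un_Int[of V W] by (simp add: flat_hull_Pow)
  next
    fix V W assume "V \<in> Pow (carrier G)" "W \<in> Pow (carrier G)" "V \<subset> W"
    then show "card V < card W" using assms(2) finite_subset by (intro psubset_card_mono) auto
  next
    fix C assume "C \<subseteq> Pow (carrier G)" "C \<noteq> {}"
    then show "\<Inter> C \<in> Pow (carrier G)" by blast
  qed (auto simp: flat_hull_Pow)
qed

lemma exists_tower_group:
  assumes n: "(\<exists>p k. Factorial_Ring.prime p \<and> n = p ^ k) \<or>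
      (\<exists>p q. Factorial_Ring.prime p \<and> Factorial_Ring.prime q \<and> p \<noteq> q \<and> n = p * q) \<or> n = 12"
    and T: "flag_type n T" and R: "group_realizable TYPE('a) n T"
  shows "\<exists>ps. prime_tower_type n ps \<and> flag_type_le n (tower_flag_type ps) T"
proof -
  obtain G :: "'a monoid" and F where G: "comm_group G" "finite (carrier G)" "order G = n"
    and F: "group_flag n G F" and TF: "\<And>i j. i < n \<Longrightarrow> j < n \<Longrightarrow> T i j = group_flag_type n G F i j"
    using R by (auto simp: group_realizable_def)
  interpret flat_group G "Pow (carrier G)" card using flat_group_Pow G(1,2) .
  have card: "card (carrier G) = n" using G(3) by (simp add: order_def)
  have mono: "F i \<subseteq> F j" if "i \<le> j" "j < n" for i j
    using chain_mono[of n F, OF _ that] F by (simp add: group_flag_def)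
  have sub: "F i \<subseteq> carrier G" if "i < n" for i
    using mono[of i "n - 1"] that F by (simp add: group_flag_def)
  interpret flat_flag G "Pow (carrier G)" card F T
  proof (unfold_locales; (unfold card)?)
    show "\<one>\<^bsub>G\<^esub> \<in> F 0" using F by (simp add: group_flag_def)
    fix i j assume ij: "i < n" "j < n"
    have "F i <#>\<^bsub>G\<^esub> F j \<subseteq> F (n - 1)"
      using sub ij F set_mult_closed by (simp add: group_flag_def)
    \<comment> \<open>The last member is the whole group, so the \<open>LEAST\<close> in the flag
      type is attained.\<close>
    then have "\<exists>k. k < n \<and> F i <#>\<^bsub>G\<^esub> F j \<subseteq> F k" using ij(1) by (intro exI[of _ "n - 1"]) simp
    from LeastI_ex[OF this] have "F i <#>\<^bsub>G\<^esub> F j \<subseteq> F (T i j)"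
      using TF[OF ij] by (simp add: group_flag_type_def)
    then show "x \<otimes>\<^bsub>G\<^esub> y \<in> F (T i j)" if "x \<in> F i" "y \<in> F j" for x y
      using that by (auto simp: set_mult_def)
  qed (use F T sub mono in \<open>auto simp: group_flag_def flag_type_def\<close>)
  show ?thesis using exists_tower n by (simp add: card)
qed

locale finite_field_extension = field L for L (structure) +
  fixes K :: "'a set" and n :: nat
  assumes K: "subfield K L" and dim_L: "dimension n K (carrier L)"
begin

definition subspaces :: "'a set set" where
  "subspaces = {A. \<zero> \<notin> A \<and> subalgebra K (insert \<zero> A) L}"

definition sdim :: "'a set \<Rightarrow> nat" where "sdim A = (dim over K) (insert \<zero> A)"

lemma subalgebra_zero: "subalgebra K V L \<Longrightarrow> \<zero> \<in> V"
  using subgroup.one_closed[of V "add_monoid L"] by (simp add: subalgebra_def)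

lemma subspacesI: "subalgebra K V L \<Longrightarrow> V - {\<zero>} \<in> subspaces"
  using subalgebra_zero[of V] by (simp add: subspaces_def insert_absorb)

lemma sdim_eq: "subalgebra K V L \<Longrightarrow> sdim (V - {\<zero>}) = (dim over K) V"
  using subalgebra_zero[of V] by (simp add: sdim_def insert_absorb)

lemma finite_dim: "subalgebra K V L \<Longrightarrow> finite_dimension K V"
  using subalbegra_incl_imp_finite_dimension[OF K finite_dimensionI[OF dim_L]] subalgebra_in_carrier by blast

lemma dim_subalgebra: "subalgebra K V L \<Longrightarrow> dimension ((dim over K) V) K V"
  using finite_dimensionE[OF K finite_dim] .

lemma K_carrier: "K \<subseteq> carrier L"
  using subfieldE(3)[OF K] .

lemma dim_psubset:
  assumes "subalgebra K V L" "subalgebra K W L" "V \<subset> W"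
  shows "(dim over K) V < (dim over K) W"
proof -
  obtain Us where Us: "set Us \<subseteq> carrier L" "independent K Us" "length Us = (dim over K) V" "Span K Us = V"
    using exists_base[OF K dim_subalgebra[OF assms(1)]] by blast
  have sub: "set Us \<subseteq> W" using Span_base_incl[OF K Us(1)] Us(4) assms(3) by blast
  have "length Us \<le> (dim over K) W"
    using independent_length_le_dimension[OF K dim_subalgebra[OF assms(2)] Us(2) sub] .
  moreover have "length Us \<noteq> (dim over K) W"
    using independent_length_eq_dimension[OF K dim_subalgebra[OF assms(2)] Us(2) sub] Us(4) assms(3) by blast
  ultimately show ?thesis using Us(3) by simp
qed

lemma line_extension_scale:
  assumes "u \<in> carrier L" "v \<in> carrier L" "E \<subseteq> carrier L"
  shows "(\<lambda>x. u \<otimes> x) ` line_extension K v E = line_extension K (u \<otimes> v) ((\<lambda>x. u \<otimes> x) ` E)"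
proof -
  have eq: "u \<otimes> (k \<otimes> v \<oplus> w) = k \<otimes> (u \<otimes> v) \<oplus> u \<otimes> w" if "k \<in> K" "w \<in> E" for k w
  proof -
    have "k \<in> carrier L" "w \<in> carrier L" using that K_carrier assms(3) by blast+
    then show ?thesis using assms(1,2) by (simp add: r_distr m_lcomm)
  qed
  have "line_extension K v E = (\<lambda>(k, w). k \<otimes> v \<oplus> w) ` (K \<times> E)"
    "line_extension K (u \<otimes> v) ((\<lambda>x. u \<otimes> x) ` E) = (\<lambda>(k, w). k \<otimes> (u \<otimes> v) \<oplus> u \<otimes> w) ` (K \<times> E)"
    by (auto simp: line_extension_mem_iff set_eq_iff)
  then show ?thesis by (simp add: image_image) (rule image_cong, simp, use eq in auto)
qed

text \<open>Multiplication by a nonzero \<open>u\<close> is injective and maps a basis, built up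
  line by line, to a basis.\<close>

lemma dimension_scale:
  assumes u: "u \<in> carrier L" "u \<noteq> \<zero>" and E: "dimension m K E"
  shows "dimension m K ((\<lambda>x. u \<otimes> x) ` E)"
proof -
  obtain Us where Us: "set Us \<subseteq> carrier L" "independent K Us" "length Us = m" "Span K Us = E"
    using exists_base[OF K E] by blast
  have "dimension (length Us) K ((\<lambda>x. u \<otimes> x) ` Span K Us)"
    using Us(2)
  proof (induction Us rule: list.induct)
    case Nil
    then show ?case using u by simp
  next
    case (Cons v Vs)
    then have v: "v \<in> carrier L" "v \<notin> Span K Vs" "independent K Vs"
      using independent_backwards by blast+
    have E: "Span K Vs \<subseteq> carrier L"
      using Span_in_carrier[OF K_carrier independent_in_carrier[OF v(3)]] .
    have "u \<otimes> v \<notin> (\<lambda>x. u \<otimes> x) ` Span K Vs"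
      using v(1,2) u E by (auto simp: m_lcancel subset_iff simp del: Span.simps)
    then show ?case
      using dimension.Suc_dim[OF _ _ Cons.IH[OF v(3)], of "u \<otimes> v"] u(1) v(1)
        line_extension_scale[OF u(1) v(1) E] by simp
  qed
  then show ?thesis using Us by simp
qed

lemma subalgebra_Inter:
  assumes "\<A> \<noteq> {}" "\<And>V. V \<in> \<A> \<Longrightarrow> subalgebra K V L"
  shows "subalgebra K (\<Inter>\<A>) L"
proof (rule subalgebra.intro)
  show "subgroup (\<Inter>\<A>) (add_monoid L)"
    using assms subalgebra.axioms(1) by (intro add.subgroups_Inter) blast+
  show "subalgebra_axioms K (\<Inter>\<A>) L"
    using assms subalgebra.smult_closed by (fastforce intro: subalgebra_axioms.intro)
qed

lemma hull_subspaces: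
  assumes "subalgebra K V L" "A \<subseteq> V - {\<zero>}"
    and min: "\<And>W. subalgebra K W L \<Longrightarrow> A \<subseteq> W \<Longrightarrow> V \<subseteq> W"
  shows "flat_hull subspaces A = V - {\<zero>}"
proof
  show "flat_hull subspaces A \<subseteq> V - {\<zero>}"
    using subspacesI[OF assms(1)] assms(2) by (auto simp: flat_hull_def)
  have "V - {\<zero>} \<subseteq> B" if "B \<in> subspaces" "A \<subseteq> B" for B
    using min[of "insert \<zero> B"] that by (auto simp: subspaces_def)
  then show "V - {\<zero>} \<subseteq> flat_hull subspaces A" by (auto simp: flat_hull_def)
qed

text \<open>Modularity is the dimension formula for sums of subspaces, the hull of a union being the
  sum without zero.\<close>

lemma flat_group_subspaces: "flat_group (Multiplicative_Group.mult_of L) subspaces sdim"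
proof -
  have "group (Multiplicative_Group.mult_of L)" by (rule field_mult_group)
  then interpret comm_group "Multiplicative_Group.mult_of L"
    by (rule group.group_comm_groupI) (auto simp: m_comm)
  have zero: "subalgebra K {\<zero>} L" using Span_is_subalgebra[OF K, of "[]"] by simp
  have dim0: "(dim over K) {\<zero>} = 0" using dimI[OF K zero_dim] .
  show ?thesis
  proof
    show "V \<subseteq> carrier (Multiplicative_Group.mult_of L)" if "V \<in> subspaces" for V
      using that subalgebra_in_carrier by (force simp: subspaces_def)
    show "carrier (Multiplicative_Group.mult_of L) \<in> subspaces"
      using subspacesI[OF carrier_is_subalgebra[OF K_carrier]] by simp
    show "{} \<in> subspaces" using zero by (simp add: subspaces_def)
    show "sdim {} = 0" using dim0 by (simp add: sdim_def)
  next
    fix C assume C: "C \<subseteq> subspaces" "C \<noteq> {}"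
    have "insert \<zero> (\<Inter>C) = \<Inter>(insert \<zero> ` C)" using C(2) by auto
    moreover have "subalgebra K (\<Inter>(insert \<zero> ` C)) L"
      using C by (intro subalgebra_Inter) (auto simp: subspaces_def)
    ultimately show "\<Inter>C \<in> subspaces" using C by (auto simp: subspaces_def)
  next
    fix u V assume u: "u \<in> carrier (Multiplicative_Group.mult_of L)" and V: "V \<in> subspaces"
    have sV: "subalgebra K (insert \<zero> V) L" "\<zero> \<notin> V" "V \<subseteq> carrier L"
      using V subalgebra_in_carrier by (auto simp: subspaces_def)
    have e: "insert \<zero> (u <#\<^bsub>Multiplicative_Group.mult_of L\<^esub> V) = (\<lambda>x. u \<otimes> x) ` insert \<zero> V"
      using u by (auto simp: l_coset_def)
    have nz: "\<zero> \<notin> u <#\<^bsub>Multiplicative_Group.mult_of L\<^esub> V" using u sV integral by (fastforce simp: l_coset_def)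
    have dm: "dimension ((dim over K) (insert \<zero> V)) K (insert \<zero> (u <#\<^bsub>Multiplicative_Group.mult_of L\<^esub> V))"
      unfolding e using dimension_scale[OF _ _ dim_subalgebra[OF sV(1)]] u by simp
    show "u <#\<^bsub>Multiplicative_Group.mult_of L\<^esub> V \<in> subspaces"
      using nz finite_dimension_imp_subalgebra[OF K finite_dimensionI[OF dm]] by (simp add: subspaces_def)
    show "sdim (u <#\<^bsub>Multiplicative_Group.mult_of L\<^esub> V) = sdim V"
      using dimI[OF K dm] by (simp add: sdim_def)
  next
    fix V W assume "V \<in> subspaces" "W \<in> subspaces" "V \<subset> W"
    then show "sdim V < sdim W"
      unfolding sdim_def by (intro dim_psubset) (auto simp: subspaces_def psubset_eq insert_ident)
  next
    fix u assume u: "u \<in> carrier (Multiplicative_Group.mult_of L)"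
    have ind: "independent K [u]" using u li_Cons[of u K "[]"] by simp
    have uL: "set [u] \<subseteq> carrier L" using u by simp
    have sp: "subalgebra K (Span K [u]) L" using Span_is_subalgebra[OF K uL] .
    have h: "flat_hull subspaces {u} = Span K [u] - {\<zero>}"
    proof (rule hull_subspaces[OF sp])
      show "{u} \<subseteq> Span K [u] - {\<zero>}" using Span_base_incl[OF K uL] u by auto
      show "Span K [u] \<subseteq> W" if "subalgebra K W L" "{u} \<subseteq> W" for W
        using subalgebra_Span_incl[OF K that(1), of "[u]"] that(2) by simp
    qed
    have "(dim over K) (Span K [u]) = 1" using dimI[OF K dimension_independent[OF ind]] by simp
    then show "sdim (flat_hull subspaces {u}) = 1" unfolding h using sdim_eq[OF sp] by simp
  next
    fix V W assume V: "V \<in> subspaces" and W: "W \<in> subspaces"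
    let ?V = "insert \<zero> V" and ?W = "insert \<zero> W"
    have sV: "subalgebra K ?V L" "\<zero> \<notin> V" "?V \<subseteq> carrier L"
      and sW: "subalgebra K ?W L" "\<zero> \<notin> W" "?W \<subseteq> carrier L"
      using V W subalgebra_in_carrier by (auto simp: subspaces_def)
    note sum = sum_space_dim[OF K finite_dim[OF sV(1)] finite_dim[OF sW(1)]]
    have sp: "subalgebra K (?V <+>\<^bsub>L\<^esub> ?W) L" using finite_dimension_imp_subalgebra[OF K sum(1)] .
    have h: "flat_hull subspaces (V \<union> W) = (?V <+>\<^bsub>L\<^esub> ?W) - {\<zero>}"
    proof (rule hull_subspaces[OF sp])
      have "x \<in> ?V <+>\<^bsub>L\<^esub> ?W" if "x \<in> V" for x
        using that sV(3) set_add_def' by (fastforce simp: set_add_def' intro!: bexI[of _ x])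
      moreover have "x \<in> ?V <+>\<^bsub>L\<^esub> ?W" if "x \<in> W" for x
        using that sW(3) by (fastforce simp: set_add_def' intro!: bexI[of _ x])
      ultimately show "V \<union> W \<subseteq> (?V <+>\<^bsub>L\<^esub> ?W) - {\<zero>}" using sV(2) sW(2) by blast
      fix Z assume Z: "subalgebra K Z L" "V \<union> W \<subseteq> Z"
      then have "x \<oplus> y \<in> Z" if "x \<in> ?V" "y \<in> ?W" for x y
        using that subgroup.m_closed[OF subalgebra.axioms(1)[OF Z(1)], of x y] subalgebra_zero[OF Z(1)] by auto
      then have "x \<oplus> y \<in> Z" if "x \<in> ?V" "y \<in> ?W" for x y using that by blast
      then show "?V <+>\<^bsub>L\<^esub> ?W \<subseteq> Z" unfolding set_add_def' by blast
    qed
    have si: "subalgebra K (?V \<inter> ?W) L" using subalgebra_inter[OF sV(1) sW(1)] .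
    have "(dim over K) (?V \<inter> ?W) \<le> (dim over K) ?V"
    proof (cases "?V \<inter> ?W = ?V")
      case False
      then have "?V \<inter> ?W \<subset> ?V" by blast
      then show ?thesis using dim_psubset[OF si sV(1)] by simp
    qed simp
    then have "sdim (flat_hull subspaces (V \<union> W)) + (dim over K) (?V \<inter> ?W) = sdim V + sdim W"
      unfolding h using sdim_eq[OF sp] sum(2) by (simp add: sdim_def)
    moreover have "?V \<inter> ?W = insert \<zero> (V \<inter> W)" by auto
    ultimately show "sdim (flat_hull subspaces (V \<union> W)) + sdim (V \<inter> W) = sdim V + sdim W"
      by (simp add: sdim_def)
  qed
qed

lemma exists_tower_field:
  assumes n: "(\<exists>p k. Factorial_Ring.prime p \<and> n = p ^ k) \<or>
      (\<exists>p q. Factorial_Ring.prime p \<and> Factorial_Ring.prime q \<and> p \<noteq> q \<and> n = p * q) \<or> n = 12"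
    and T: "flag_type n T" and F: "field_flag n K L F"
    and TF: "\<And>i j. i < n \<Longrightarrow> j < n \<Longrightarrow> T i j = field_flag_type n K L F i j"
  shows "\<exists>ps. prime_tower_type n ps \<and> flag_type_le n (tower_flag_type ps) T"
proof -
  interpret fg: flat_group "Multiplicative_Group.mult_of L" subspaces sdim by (rule flat_group_subspaces)
  have dimn: "sdim (carrier (Multiplicative_Group.mult_of L)) = n"
    using sdim_eq[OF carrier_is_subalgebra[OF K_carrier]] dimI[OF K dim_L] by simp
  have mono: "F i \<subseteq> F j" if "i \<le> j" "j < n" for i j
    using chain_mono[of n F, OF _ that] F by (simp add: field_flag_def)
  have sF: "subalgebra K (F i) L" and dF: "dimension (i + 1) K (F i)" if "i < n" for i
    using F that by (simp_all add: field_flag_def)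
  have sub: "F i \<subseteq> carrier L" if "i < n" for i using subalgebra_in_carrier[OF sF[OF that]] .
  have prod: "x \<otimes> y \<in> F (T i j)" if ij: "i < n" "j < n" and xy: "x \<in> F i" "y \<in> F j" for i j x y
  proof -
    have last: "F (n - 1) = carrier L" using F by (simp add: field_flag_def)
    have P: "F i <#> F j \<subseteq> carrier L" using set_mult_closed[OF sub[OF ij(1)] sub[OF ij(2)]] .
    have "Span K Us \<subseteq> carrier L" if "Us \<in> lists (F i <#> F j)" for Us
      using that P Span_in_carrier[OF K_carrier, of Us] by (auto simp: in_lists_conv_set)
    then have "set_span L K (F i <#> F j) \<subseteq> F (n - 1)"
      unfolding last set_span_def by blast
    then have "\<exists>k. k < n \<and> set_span L K (F i <#> F j) \<subseteq> F k"
      using ij(1) by (intro exI[of _ "n - 1"]) simp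
    from LeastI_ex[OF this] have S: "set_span L K (F i <#> F j) \<subseteq> F (T i j)"
      using TF[OF ij] by (simp add: field_flag_type_def)
    have m: "x \<otimes> y \<in> F i <#> F j" using xy by (auto simp: set_mult_def)
    then have "set [x \<otimes> y] \<subseteq> carrier L" using P by auto
    then have "x \<otimes> y \<in> Span K [x \<otimes> y]" using Span_base_incl[OF K, of "[x \<otimes> y]"] by (simp del: Span.simps)
    then have "x \<otimes> y \<in> set_span L K (F i <#> F j)"
      unfolding set_span_def using m by (intro UN_I[of "[x \<otimes> y]"]) auto
    then show ?thesis using S by blast
  qed
  interpret flat_flag "Multiplicative_Group.mult_of L" subspaces sdim "\<lambda>i. F i - {\<zero>}" T
  proof (unfold_locales; (unfold dimn)?)
    fix i j assume i: "i < n"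
    show "F i - {\<zero>} \<in> subspaces" using subspacesI[OF sF[OF i]] .
    show "sdim (F i - {\<zero>}) = i + 1" using sdim_eq[OF sF[OF i]] dimI[OF K dF[OF i]] by simp
    assume j: "j < n"
    show "T i j < n" "T i j = T j i" using T i j by (simp_all add: flag_type_def)
    fix x y assume "x \<in> F i - {\<zero>}" "y \<in> F j - {\<zero>}"
    then show "x \<otimes>\<^bsub>Multiplicative_Group.mult_of L\<^esub> y \<in> F (T i j) - {\<zero>}"
      using prod[OF i j, of x y] sub[OF i] sub[OF j] integral[of x y] by auto
  next
    show "F i - {\<zero>} \<subseteq> F j - {\<zero>}" if "i \<le> j" "j < n" for i j using mono[OF that] by blast
    show "\<one>\<^bsub>Multiplicative_Group.mult_of L\<^esub> \<in> F 0 - {\<zero>}" using F subringE(3)[OF subfieldE(1)[OF K]] by (simp add: field_flag_def)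
  qed
  show ?thesis using exists_tower n unfolding dimn by blast
qed

end

theorem theorem5p1:
  fixes n :: nat and T :: "nat \<Rightarrow> nat \<Rightarrow> nat"
  assumes "(\<exists>p k :: nat. Factorial_Ring.prime p \<and> k \<ge> 1 \<and> n = p ^ k) \<or>
           (\<exists>p q :: nat. Factorial_Ring.prime p \<and> Factorial_Ring.prime q \<and> p \<noteq> q \<and> n = p * q) \<or>
           n = 12"
    and "realizable TYPE('a) TYPE('b) n T"
  shows "\<exists>ps. prime_tower_type n ps \<and> flag_type_le n (tower_flag_type ps) T"
proof -
  have n: "(\<exists>p k. Factorial_Ring.prime p \<and> n = p ^ k) \<or>
      (\<exists>p q. Factorial_Ring.prime p \<and> Factorial_Ring.prime q \<and> p \<noteq> q \<and> n = p * q) \<or> n = 12"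
    using assms(1) by blast
  have T: "flag_type n T" using assms(2) by (simp add: realizable_def)
  from assms(2) consider "group_realizable (TYPE('a)) n T" | "field_realizable (TYPE('b)) n T"
    by (auto simp: realizable_def)
  then show ?thesis
  proof cases
    case 1
    then show ?thesis using exists_tower_group[OF n T] by blast
  next
    case 2
    then obtain L :: "'b ring" and K F where L: "field L" "subfield K L" "ring.dimension L n K (carrier L)"
      "field_flag n K L F" "\<And>i j. i < n \<Longrightarrow> j < n \<Longrightarrow> T i j = field_flag_type n K L F i j"
      by (auto simp: field_realizable_def)
    interpret field L by fact
    interpret finite_field_extension L K n
      using L(2,3) by (intro finite_field_extension.intro field_axioms finite_field_extension_axioms.intro)
    show ?thesis using exists_tower_field[OF n T L(4,5)] .
  qed
qed

end
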